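(* Let $M$ be a countable complete metric space. Then $\mathcal{F}(M)$ has the Schur property. More generally, let $M$ be a scattered complete metric space. Then $\mathcal{F}(M)$ has the Schur property.
   Context: All metric spaces come with a distinguished base point $0$. $\mathrm{Lip}_0(M)$ is the Banach space of real-valued Lipschitz functions $f$ on $M$ with $f(0)=0$, normed by the best Lipschitz constant. For $x\in M$ let $\delta(x)\in\mathrm{Lip}_0(M)^*$ be $\delta(x)(f)=f(x)$. The Lipschitz-free space is $\mathcal{F}(M)=\overline{\operatorname{span}}\{\delta(x):x\in M\}\subset\mathrm{Lip}_0(M)^*$ (norm closure). A Banach space has the Schur property if every weakly null sequence in it converges to $0$ in norm. A metric space is scattered if it contains no nonempty perfect subset, i.e. every nonempty subset has an isolated point (in its relative topology). *)

theory Defs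
  imports "HOL-Analysis.Analysis"
begin

section \<open>Pointed metric spaces and the space of Lipschitz functions\<close>

text \<open>The distinguished point is a class parameter without axioms, so that the type of Lipschitz
  functions vanishing at it depends only on the type of points.\<close>

class pointed_metric_space = metric_space +
  fixes base_pt :: 'a

typedef (overloaded) 'a lip0 =
  "{f :: 'a::pointed_metric_space \<Rightarrow> real. f base_pt = 0 \<and> (\<exists>C. C-lipschitz_on UNIV f)}"
  morphisms lip0_apply Abs_lip0
  by (rule exI[of _ "\<lambda>_. 0"]) (auto intro: lipschitz_on_constant)

setup_lifting type_definition_lip0

lemma lip0_apply_base [simp]: "lip0_apply f base_pt = 0"
  using lip0_apply[of f] by simp

definition best_lipschitz :: "('a::metric_space \<Rightarrow> 'b::metric_space) \<Rightarrow> real"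
  where "best_lipschitz f = Inf {C. C-lipschitz_on UNIV f}"

lemma best_lipschitz_le: "C-lipschitz_on UNIV f \<Longrightarrow> best_lipschitz f \<le> C"
  unfolding best_lipschitz_def
  by (rule cInf_lower) (auto intro: bdd_belowI[of _ 0] lipschitz_on_nonneg)

lemma best_lipschitz_attained:
  assumes "C-lipschitz_on UNIV f"
  shows "(best_lipschitz f)-lipschitz_on UNIV f"
proof (rule lipschitz_onI)
  have ne: "{C. C-lipschitz_on UNIV f} \<noteq> {}"
    using assms by blast
  show "0 \<le> best_lipschitz f"
    unfolding best_lipschitz_def by (rule cInf_greatest[OF ne]) (auto intro: lipschitz_on_nonneg)
  fix x y
  show "dist (f x) (f y) \<le> best_lipschitz f * dist x y"
  proof (cases "x = y")
    case False
    have "dist (f x) (f y) / dist x y \<le> best_lipschitz f"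
      unfolding best_lipschitz_def
    proof (rule cInf_greatest[OF ne])
      fix C assume "C \<in> {C. C-lipschitz_on UNIV f}"
      then have "dist (f x) (f y) \<le> C * dist x y"
        by (auto intro: lipschitz_onD)
      then show "dist (f x) (f y) / dist x y \<le> C"
        using False by (simp add: divide_le_eq)
    qed
    then show ?thesis
      using False by (simp add: divide_le_eq)
  qed simp
qed

instantiation lip0 :: (pointed_metric_space) real_normed_vector
begin

lift_definition zero_lip0 :: "'a lip0" is "\<lambda>_. 0"
  by (auto intro: lipschitz_on_constant)

lift_definition plus_lip0 :: "'a lip0 \<Rightarrow> 'a lip0 \<Rightarrow> 'a lip0" is "\<lambda>f g x. f x + g x"
  by (auto intro: lipschitz_on_add)

lift_definition uminus_lip0 :: "'a lip0 \<Rightarrow> 'a lip0" is "\<lambda>f x. - f x"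
  by (auto intro: lipschitz_on_minus)

lift_definition minus_lip0 :: "'a lip0 \<Rightarrow> 'a lip0 \<Rightarrow> 'a lip0" is "\<lambda>f g x. f x - g x"
  by (auto intro: lipschitz_on_diff)

lift_definition scaleR_lip0 :: "real \<Rightarrow> 'a lip0 \<Rightarrow> 'a lip0" is "\<lambda>r f x. r *\<^sub>R f x"
  by (auto intro: lipschitz_on_cmult_real)

lift_definition norm_lip0 :: "'a lip0 \<Rightarrow> real" is best_lipschitz .

definition sgn_lip0 :: "'a lip0 \<Rightarrow> 'a lip0"
  where "sgn_lip0 f = scaleR (inverse (norm f)) f"

definition dist_lip0 :: "'a lip0 \<Rightarrow> 'a lip0 \<Rightarrow> real"
  where "dist_lip0 f g = norm (f - g)"

definition uniformity_lip0 :: "('a lip0 \<times> 'a lip0) filter"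
  where "uniformity_lip0 = (INF e\<in>{0 <..}. principal {(f, g). dist f g < e})"

definition open_lip0 :: "'a lip0 set \<Rightarrow> bool"
  where "open_lip0 S = (\<forall>f\<in>S. \<forall>\<^sub>F (f', g) in uniformity. f' = f \<longrightarrow> g \<in> S)"

lemma lip0_lipschitz: "(norm f)-lipschitz_on UNIV (lip0_apply f)"
  by transfer (auto intro: best_lipschitz_attained)

lemma norm_lip0_le: "C-lipschitz_on UNIV (lip0_apply f) \<Longrightarrow> norm f \<le> C"
  by transfer (rule best_lipschitz_le)

instance
proof
  fix f g h :: "'a lip0" and a b :: real
  show "f + g + h = f + (g + h)" "f + g = g + f" "0 + f = f" "- f + f = 0" "f - g = f + - g"
    by (transfer; simp add: fun_eq_iff)+
  show "a *\<^sub>R (f + g) = a *\<^sub>R f + a *\<^sub>R g" "(a + b) *\<^sub>R f = a *\<^sub>R f + b *\<^sub>R f"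
    "a *\<^sub>R b *\<^sub>R f = (a * b) *\<^sub>R f" "1 *\<^sub>R f = f"
    by (transfer; simp add: fun_eq_iff algebra_simps)+
  show "sgn f = scaleR (inverse (norm f)) f"
    by (rule sgn_lip0_def)
  show "dist f g = norm (f - g)"
    by (rule dist_lip0_def)
  show "(uniformity :: ('a lip0 \<times> 'a lip0) filter) = (INF e\<in>{0 <..}. principal {(f, g). dist f g < e})"
    by (rule uniformity_lip0_def)
  show "open U = (\<forall>f\<in>U. \<forall>\<^sub>F (f', g) in uniformity. f' = f \<longrightarrow> g \<in> U)" for U :: "'a lip0 set"
    by (rule open_lip0_def)
  show "norm (f + g) \<le> norm f + norm g"
    using lipschitz_on_add[OF lip0_lipschitz[of f] lip0_lipschitz[of g]]
    by (intro norm_lip0_le) (simp add: plus_lip0.rep_eq)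
  show "norm f = 0 \<longleftrightarrow> f = 0"
  proof
    assume "norm f = 0"
    then have "lip0_apply f x = 0" for x
      using lipschitz_onD[OF lip0_lipschitz[of f], of x base_pt] by simp
    then show "f = 0"
      by transfer auto
  next
    have "norm (0 :: 'a lip0) \<le> 0"
      by (rule norm_lip0_le) (simp add: zero_lip0.rep_eq lipschitz_on_constant)
    then show "f = 0 \<Longrightarrow> norm f = 0"
      using lipschitz_on_nonneg[OF lip0_lipschitz[of f]] by simp
  qed
  have le: "norm (c *\<^sub>R k) \<le> \<bar>c\<bar> * norm k" for c and k :: "'a lip0"
    using lipschitz_on_cmult_real[OF lip0_lipschitz[of k], of c]
    by (intro norm_lip0_le) (simp add: scaleR_lip0.rep_eq)
  show "norm (a *\<^sub>R f) = \<bar>a\<bar> * norm f"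
  proof (cases "a = 0")
    case True
    then show ?thesis
      using le[of a f] lipschitz_on_nonneg[OF lip0_lipschitz[of "a *\<^sub>R f"]] by simp
  next
    case False
    have "inverse a *\<^sub>R a *\<^sub>R f = f"
      using False by (transfer; simp add: fun_eq_iff)
    then have "norm f \<le> \<bar>inverse a\<bar> * norm (a *\<^sub>R f)"
      using le[of "inverse a" "a *\<^sub>R f"] by simp
    then have "\<bar>a\<bar> * norm f \<le> norm (a *\<^sub>R f)"
      using False by (simp add: abs_inverse field_simps)
    then show ?thesis
      using le[of a f] by simp
  qed
qed

end

lemma abs_lip0_apply_le: "\<bar>lip0_apply f x\<bar> \<le> norm f * dist x base_pt"
  using lipschitz_onD[OF lip0_lipschitz[of f], of x base_pt] by (simp add: dist_real_def)

section \<open>The Lipschitz-free space\<close>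

lift_definition delta :: "'a::pointed_metric_space \<Rightarrow> 'a lip0 \<Rightarrow>\<^sub>L real" is "\<lambda>x f. lip0_apply f x"
proof (rule bounded_linear_intro)
  fix x :: 'a and f g :: "'a lip0" and r :: real
  show "lip0_apply (f + g) x = lip0_apply f x + lip0_apply g x"
    by (simp add: plus_lip0.rep_eq)
  show "lip0_apply (r *\<^sub>R f) x = r *\<^sub>R lip0_apply f x"
    by (simp add: scaleR_lip0.rep_eq)
  show "norm (lip0_apply f x) \<le> norm f * dist x base_pt"
    using abs_lip0_apply_le by simp
qed

typedef (overloaded) 'a lipfree =
  "closure (span (range (delta :: 'a::pointed_metric_space \<Rightarrow> 'a lip0 \<Rightarrow>\<^sub>L real)))"
  morphisms lipfree_functional Abs_lipfree
  using closure_subset span_zero by blast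

setup_lifting type_definition_lipfree

lemma subspace_lipfree: "subspace (closure (span (range (delta :: 'a::pointed_metric_space \<Rightarrow> _))))"
proof (rule subspaceI)
  let ?S = "span (range (delta :: 'a \<Rightarrow> _))"
  show "0 \<in> closure ?S"
    using closure_subset span_zero by blast
  fix u v assume u: "u \<in> closure ?S"
  then obtain f where f: "\<And>n. f n \<in> ?S" "f \<longlonglongrightarrow> u"
    by (auto simp: closure_sequential)
  show "c *\<^sub>R u \<in> closure ?S" for c
    unfolding closure_sequential using f
    by (intro exI[of _ "\<lambda>n. c *\<^sub>R f n"]) (auto intro: span_scale tendsto_intros)
  assume "v \<in> closure ?S"
  then obtain g where g: "\<And>n. g n \<in> ?S" "g \<longlonglongrightarrow> v"
    by (auto simp: closure_sequential)
  show "u + v \<in> closure ?S"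
    unfolding closure_sequential using f g
    by (intro exI[of _ "\<lambda>n. f n + g n"]) (auto intro: span_add tendsto_intros)
qed

instantiation lipfree :: (pointed_metric_space) real_normed_vector
begin

lift_definition zero_lipfree :: "'a lipfree" is 0
  by (rule subspace_0[OF subspace_lipfree])

lift_definition plus_lipfree :: "'a lipfree \<Rightarrow> 'a lipfree \<Rightarrow> 'a lipfree" is "(+)"
  by (rule subspace_add[OF subspace_lipfree])

lift_definition uminus_lipfree :: "'a lipfree \<Rightarrow> 'a lipfree" is uminus
  by (rule subspace_neg[OF subspace_lipfree])

lift_definition minus_lipfree :: "'a lipfree \<Rightarrow> 'a lipfree \<Rightarrow> 'a lipfree" is "(-)"
  by (rule subspace_diff[OF subspace_lipfree])

lift_definition scaleR_lipfree :: "real \<Rightarrow> 'a lipfree \<Rightarrow> 'a lipfree" is scaleR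
  by (rule subspace_scale[OF subspace_lipfree])

lift_definition norm_lipfree :: "'a lipfree \<Rightarrow> real" is norm .

definition sgn_lipfree :: "'a lipfree \<Rightarrow> 'a lipfree"
  where "sgn_lipfree u = scaleR (inverse (norm u)) u"

definition dist_lipfree :: "'a lipfree \<Rightarrow> 'a lipfree \<Rightarrow> real"
  where "dist_lipfree u v = norm (u - v)"

definition uniformity_lipfree :: "('a lipfree \<times> 'a lipfree) filter"
  where "uniformity_lipfree = (INF e\<in>{0 <..}. principal {(u, v). dist u v < e})"

definition open_lipfree :: "'a lipfree set \<Rightarrow> bool"
  where "open_lipfree S = (\<forall>u\<in>S. \<forall>\<^sub>F (u', v) in uniformity. u' = u \<longrightarrow> v \<in> S)"

instance
proof
  fix u v w :: "'a lipfree" and a b :: real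
  show "u + v + w = u + (v + w)" "u + v = v + u" "0 + u = u" "- u + u = 0" "u - v = u + - v"
    by (transfer; simp)+
  show "a *\<^sub>R (u + v) = a *\<^sub>R u + a *\<^sub>R v" "(a + b) *\<^sub>R u = a *\<^sub>R u + b *\<^sub>R u"
    "a *\<^sub>R b *\<^sub>R u = (a * b) *\<^sub>R u" "1 *\<^sub>R u = u"
    by (transfer; simp add: scaleR_add_right scaleR_add_left)+
  show "sgn u = scaleR (inverse (norm u)) u"
    by (rule sgn_lipfree_def)
  show "dist u v = norm (u - v)"
    by (rule dist_lipfree_def)
  show "(uniformity :: ('a lipfree \<times> 'a lipfree) filter) = (INF e\<in>{0 <..}. principal {(u, v). dist u v < e})"
    by (rule uniformity_lipfree_def)
  show "open U = (\<forall>u\<in>U. \<forall>\<^sub>F (u', v) in uniformity. u' = u \<longrightarrow> v \<in> U)" for U :: "'a lipfree set"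
    by (rule open_lipfree_def)
  show "norm u = 0 \<longleftrightarrow> u = 0" "norm (u + v) \<le> norm u + norm v" "norm (a *\<^sub>R u) = \<bar>a\<bar> * norm u"
    by (transfer; simp add: norm_triangle_ineq)+
qed

end

instance lipfree :: (pointed_metric_space) banach
proof
  fix X :: "nat \<Rightarrow> 'a lipfree"
  assume "Cauchy X"
  have dist_eq: "dist u v = dist (lipfree_functional u) (lipfree_functional v)" for u v :: "'a lipfree"
    by (simp add: dist_norm norm_lipfree.rep_eq minus_lipfree.rep_eq)
  have "Cauchy (\<lambda>n. lipfree_functional (X n))"
    using \<open>Cauchy X\<close> by (simp add: Cauchy_def dist_eq)
  then obtain l where l: "(\<lambda>n. lipfree_functional (X n)) \<longlonglongrightarrow> l"
    using Cauchy_convergent convergent_def by blast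
  have "l \<in> closure (span (range delta))"
    by (rule closed_sequentially[OF closed_closure _ l]) (rule lipfree_functional)
  then have "lipfree_functional (Abs_lipfree l) = l"
    by (rule Abs_lipfree_inverse)
  then have "X \<longlonglongrightarrow> Abs_lipfree l"
    using l by (simp add: tendsto_iff dist_eq)
  then show "convergent X"
    by (auto simp: convergent_def)
qed

section \<open>Schur property and scattered spaces\<close>

definition weakly_null :: "(nat \<Rightarrow> 'b::real_normed_vector) \<Rightarrow> bool"
  where "weakly_null u \<longleftrightarrow> (\<forall>\<phi> :: 'b \<Rightarrow>\<^sub>L real. (\<lambda>n. blinfun_apply \<phi> (u n)) \<longlonglongrightarrow> 0)"

text \<open>The argument only selects the type, i.e. the Banach space.\<close>

definition schur_property :: "'b::banach itself \<Rightarrow> bool"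
  where "schur_property _ \<longleftrightarrow> (\<forall>u :: nat \<Rightarrow> 'b. weakly_null u \<longrightarrow> u \<longlonglongrightarrow> 0)"

definition scattered :: "'a::topological_space set \<Rightarrow> bool"
  where "scattered S \<longleftrightarrow> (\<forall>A\<subseteq>S. A \<noteq> {} \<longrightarrow> (\<exists>x. x isolated_in A))"

end

theory Submission
  imports Defs
begin

text \<open>Finitely supported measures are dense in the free space, so it is enough to show that a weakly null
  sequence of them tends to zero uniformly over the \<open>1\<close>-Lipschitz functions \<open>f\<close> with
  \<open>f base_pt = 0\<close>; two gliding hump arguments show this. In the first, the humps are Lipschitz
  functions with disjoint supports: their sum is Lipschitz, hence a weakly null sequence is, up to a
  small norm error, concentrated near a finite set. Iterating at scales tending to zero moves the
  sequence, with a small total error, onto one compact set \<open>K\<close>.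

  Such a \<open>K\<close> is countable, so Lipschitz functions on \<open>K\<close> have countable range, and composing with a
  function that is flat near that range makes them locally constant at some scale \<open>d\<close>. In
  the second argument the humps are locally constant: adding to a sum of humps that is constant at
  scale \<open>d\<close> a hump whose sup norm is small compared to \<open>d\<close> barely changes the Lipschitz constant, and total
  boundedness of the Lipschitz ball in the sup norm provides such humps.\<close>

section \<open>Finitely supported measures\<close>

text \<open>The integral of \<open>f\<close> against the measure with point masses \<open>m\<close>,
  meant for \<open>m\<close> of finite support.\<close>

definition pairing :: "('a \<Rightarrow> real) \<Rightarrow> ('a \<Rightarrow> real) \<Rightarrow> real"
  where "pairing m f = (\<Sum>x | m x \<noteq> 0. m x * f x)"

text \<open>The test functions are the Lipschitz functions vanishing at \<open>base_pt\<close>, that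
  is, the dual of the free space, so this is weak convergence to zero. Finite supports are built in
  so that \<open>pairing\<close> is a genuine sum.\<close>

definition weakly_null_meas :: "(nat \<Rightarrow> 'a::pointed_metric_space \<Rightarrow> real) \<Rightarrow> bool"
  where "weakly_null_meas m \<longleftrightarrow> (\<forall>n. finite {x. m n x \<noteq> 0}) \<and>
    (\<forall>f C. C-lipschitz_on UNIV f \<longrightarrow> f base_pt = 0 \<longrightarrow> (\<lambda>n. pairing (m n) f) \<longlonglongrightarrow> 0)"

lemma pairing_superset:
  assumes "finite A" "{x. m x \<noteq> 0} \<subseteq> A"
  shows "pairing m f = (\<Sum>x\<in>A. m x * f x)"
  unfolding pairing_def using assms by (intro sum.mono_neutral_left) auto

lemma pairing_cong: "(\<And>x. m x \<noteq> 0 \<Longrightarrow> f x = g x) \<Longrightarrow> pairing m f = pairing m g"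
  unfolding pairing_def by (rule sum.cong) auto

lemma pairing_add: "pairing m (\<lambda>x. f x + g x) = pairing m f + pairing m g"
  by (simp add: pairing_def distrib_left sum.distrib)

lemma pairing_diff: "pairing m (\<lambda>x. f x - g x) = pairing m f - pairing m g"
  by (simp add: pairing_def right_diff_distrib sum_subtractf)

lemma pairing_uminus: "pairing m (\<lambda>x. - f x) = - pairing m f"
  by (simp add: pairing_def sum_negf)

lemma pairing_cmult: "pairing m (\<lambda>x. c * f x) = c * pairing m f"
  by (simp add: pairing_def sum_distrib_left mult_ac)

lemma pairing_weight:
  assumes "finite {x. m x \<noteq> 0}"
  shows "pairing (\<lambda>x. W x * m x) f = pairing m (\<lambda>x. W x * f x)"
proof -
  have "{x. W x * m x \<noteq> 0} \<subseteq> {x. m x \<noteq> 0}"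
    by auto
  then have "pairing (\<lambda>x. W x * m x) f = (\<Sum>x | m x \<noteq> 0. W x * m x * f x)"
    by (rule pairing_superset[OF assms])
  then show ?thesis
    by (simp add: pairing_def mult_ac)
qed

lemma abs_pairing_le:
  assumes "\<And>x. m x \<noteq> 0 \<Longrightarrow> \<bar>f x\<bar> \<le> e"
  shows "\<bar>pairing m f\<bar> \<le> e * (\<Sum>x | m x \<noteq> 0. \<bar>m x\<bar>)"
proof -
  have "\<bar>pairing m f\<bar> \<le> (\<Sum>x | m x \<noteq> 0. \<bar>m x * f x\<bar>)"
    unfolding pairing_def by (rule sum_abs)
  also have "\<dots> \<le> (\<Sum>x | m x \<noteq> 0. \<bar>m x\<bar> * e)"
    using assms by (intro sum_mono) (auto simp: abs_mult intro: mult_left_mono)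
  finally show ?thesis
    by (simp add: sum_distrib_left mult.commute)
qed

lemma tendsto_pairing:
  assumes "\<And>x. m x \<noteq> 0 \<Longrightarrow> ((\<lambda>k. f k x) \<longlongrightarrow> g x) F"
  shows "((\<lambda>k. pairing m (f k)) \<longlongrightarrow> pairing m g) F"
  unfolding pairing_def using assms by (intro tendsto_sum tendsto_mult) auto

section \<open>Extension of Lipschitz functions and the abstract gliding hump\<close>

text \<open>The extension is the infimum of the cones \<open>f y + L * dist x y\<close>. It turns
  functions controlled only on \<open>K\<close>, or limits that exist only on the supports of the
  measures, into test functions on the whole space.\<close>

lemma mcshane_extension:
  fixes f :: "'a::metric_space \<Rightarrow> real"
  assumes f: "L-lipschitz_on D f" and ne: "D \<noteq> {}"
  obtains g where "L-lipschitz_on UNIV g" "\<And>x. x \<in> D \<Longrightarrow> g x = f x"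
proof
  define g where "g x = (INF y\<in>D. f y + L * dist x y)" for x
  have L: "L \<ge> 0"
    using f by (rule lipschitz_on_nonneg)
  obtain z where z: "z \<in> D"
    using ne by blast
  have bd: "f z - L * dist x z \<le> f y + L * dist x y" if "y \<in> D" for x y
  proof -
    have "f z - f y \<le> L * dist z y"
      using lipschitz_onD[OF f z that] by (simp add: dist_real_def)
    also have "\<dots> \<le> L * (dist x z + dist x y)"
      using L by (intro mult_left_mono dist_triangle3)
    finally show ?thesis
      by (simp add: algebra_simps)
  qed
  have bdd: "bdd_below ((\<lambda>y. f y + L * dist x y) ` D)" for x
    using bd[of _ x] by (intro bdd_belowI2) blast
  have le: "g x \<le> g y + L * dist x y" for x y
  proof -
    have "g x - L * dist x y \<le> f w + L * dist y w" if "w \<in> D" for w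
    proof -
      have "g x \<le> f w + L * dist x w"
        unfolding g_def by (rule cINF_lower[OF bdd that])
      also have "\<dots> \<le> f w + L * (dist x y + dist y w)"
        using L by (intro add_left_mono mult_left_mono dist_triangle)
      finally show ?thesis
        by (simp add: algebra_simps)
    qed
    then have "g x - L * dist x y \<le> g y"
      unfolding g_def[of y] by (intro cINF_greatest ne)
    then show ?thesis
      by simp
  qed
  show "L-lipschitz_on UNIV g"
  proof (rule lipschitz_onI[OF _ L])
    fix x y
    show "dist (g x) (g y) \<le> L * dist x y"
      using le[of x y] le[of y x] by (simp add: dist_real_def dist_commute abs_if)
  qed
  show "g x = f x" if x: "x \<in> D" for x
  proof (rule antisym)
    show "g x \<le> f x"
      unfolding g_def using cINF_lower[OF bdd x, of x] by simp
    have "f x \<le> f y + L * dist x y" if "y \<in> D" for y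
      using lipschitz_onD[OF f x that] by (simp add: dist_real_def)
    then show "f x \<le> g x"
      unfolding g_def by (intro cINF_greatest ne)
  qed
qed

text \<open>\<open>S\<close> is a family of admissible sums of humps, and \<open>step\<close> adds
  one more hump that pairs well with a late measure and is tiny on a given finite set. Taking for
  this set the supports of the measures used before, the sums converge to an
  \<open>L\<close>-Lipschitz function whose pairings stay at least \<open>e / 2\<close> along a
  subsequence.\<close>

lemma gliding_hump:
  fixes m :: "nat \<Rightarrow> 'a::pointed_metric_space \<Rightarrow> real"
  assumes m: "weakly_null_meas m" and supp: "\<And>n x. m n x \<noteq> 0 \<Longrightarrow> x \<in> K" and base: "base_pt \<in> K"
    and e: "e > 0" and zero: "(\<lambda>_. 0) \<in> S"
    and S: "\<And>s. s \<in> S \<Longrightarrow> s base_pt = 0 \<and> L-lipschitz_on K s"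
    and step: "\<And>s E d N. s \<in> S \<Longrightarrow> finite E \<Longrightarrow> E \<subseteq> K \<Longrightarrow> d > 0 \<Longrightarrow>
      \<exists>n\<ge>N. \<exists>h. (\<lambda>x. s x + h x) \<in> S \<and> (\<forall>x\<in>E. \<bar>h x\<bar> \<le> d) \<and> pairing (m n) h \<ge> e"
  shows False
proof -
  have fin: "finite {x. m n x \<noteq> 0}" for n
    using m by (simp add: weakly_null_meas_def)
  have null: "(\<lambda>n. pairing (m n) f) \<longlonglongrightarrow> 0" if "C-lipschitz_on UNIV f" "f base_pt = 0" for f C
    using m that by (auto simp: weakly_null_meas_def)
  define P where "P k = (\<lambda>(s, n::nat). s \<in> S)" for k :: nat
  \<comment> \<open>The state is the current sum and the index of the last measure used. A new
    measure starts with pairing at least \<open>3 * e / 4\<close>; the later losses add up to at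
    most \<open>e / 4\<close>.\<close>
  define Q where "Q k = (\<lambda>(s, n) (s', n'). n < n' \<and> pairing (m n') s' \<ge> 3 * e / 4 \<and>
      (\<forall>i\<le>n. (\<forall>x. m i x \<noteq> 0 \<longrightarrow> \<bar>s' x - s x\<bar> \<le> (1/2) ^ k) \<and>
        pairing (m i) s' \<ge> pairing (m i) s - e / 4 * (1/2) ^ Suc k))" for k :: nat
  have "\<exists>y. P (Suc k) y \<and> Q k x y" if Px: "P k x" for k x
  proof -
    obtain s n where x: "x = (s, n)"
      by (cases x)
    have s: "s \<in> S"
      using Px by (simp add: P_def x)
    \<comment> \<open>The current sum itself is a test function after extension, so late measures
      nearly annihilate it: it costs at most \<open>e / 4\<close> of the pairing of the next
      hump.\<close>
    obtain g where g: "L-lipschitz_on UNIV g" "\<And>x. x \<in> K \<Longrightarrow> g x = s x"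
      using mcshane_extension S[OF s] base by (metis empty_iff)
    have "(\<lambda>n. pairing (m n) g) \<longlonglongrightarrow> 0"
      using null g base S[OF s] by simp
    then have "\<forall>\<^sub>F n in sequentially. \<bar>pairing (m n) g\<bar> < e / 4"
      using e by (auto simp: tendsto_iff dest!: spec[of _ "e/4"])
    moreover have "pairing (m n) g = pairing (m n) s" for n
      using g(2) supp by (intro pairing_cong) blast
    ultimately obtain N where N: "\<And>n. n \<ge> N \<Longrightarrow> \<bar>pairing (m n) s\<bar> < e / 4"
      by (auto simp: eventually_sequentially)
    define E where "E = (\<Union>i\<le>n. {x. m i x \<noteq> 0})"
    have E: "finite E" "E \<subseteq> K"
      using fin supp by (auto simp: E_def)
    define B where "B = (\<Sum>i\<le>n. \<Sum>x | m i x \<noteq> 0. \<bar>m i x\<bar>)"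
    have B: "(\<Sum>x | m i x \<noteq> 0. \<bar>m i x\<bar>) \<le> B" if "i \<le> n" for i
      unfolding B_def using that by (intro member_le_sum) (auto intro: sum_nonneg)
    have B0: "B \<ge> 0"
      unfolding B_def by (intro sum_nonneg) auto
    define c where "c = e / 4 * (1/2) ^ Suc k"
    have c: "c > 0"
      using e by (simp add: c_def)
    \<comment> \<open>The first bound makes the sums converge on the supports, the second limits the
      effect of the new hump on each earlier measure to \<open>c\<close>.\<close>
    define d where "d = min ((1/2) ^ k) (c / (B + 1))"
    have d: "d > 0" "d \<le> (1/2) ^ k"
      using c B0 by (auto simp: d_def)
    have "d * B \<le> c / (B + 1) * B"
      using B0 by (intro mult_right_mono) (auto simp: d_def)
    also have "\<dots> \<le> c"
      using c B0 by (simp add: field_simps)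
    finally have dB: "d * B \<le> c" .
    obtain n' h where h: "n' \<ge> max N (Suc n)" "(\<lambda>x. s x + h x) \<in> S" "\<And>x. x \<in> E \<Longrightarrow> \<bar>h x\<bar> \<le> d"
        "pairing (m n') h \<ge> e"
      using step[OF s E d(1), of "max N (Suc n)"] by auto
    have "\<bar>pairing (m i) h\<bar> \<le> c" if i: "i \<le> n" for i
    proof -
      have "\<bar>pairing (m i) h\<bar> \<le> d * (\<Sum>x | m i x \<noteq> 0. \<bar>m i x\<bar>)"
        using h(3) i by (intro abs_pairing_le) (auto simp: E_def)
      also have "\<dots> \<le> d * B"
        using B[OF i] d by (intro mult_left_mono) auto
      finally show ?thesis
        using dB by simp
    qed
    then have "Q k x (\<lambda>x. s x + h x, n')"
      using h N[of n'] d(2) by (fastforce simp: Q_def x pairing_add c_def E_def)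
    then show ?thesis
      using h(2) by (intro exI[of _ "(\<lambda>x. s x + h x, n')"]) (auto simp: P_def)
  qed
  moreover have "P 0 (\<lambda>_. 0, 0)"
    using zero by (simp add: P_def)
  ultimately obtain st where st: "\<And>k. P k (st k)" "\<And>k. Q k (st k) (st (Suc k))"
    using dependent_nat_choice[of P Q] by metis
  define s n where "s k = fst (st k)" and "n k = snd (st k)" for k
  have sS: "s k \<in> S" for k
    using st(1)[of k] by (simp add: P_def s_def split_beta)
  have Q: "n k < n (Suc k)" "pairing (m (n (Suc k))) (s (Suc k)) \<ge> 3 * e / 4"
      "\<And>i x. i \<le> n k \<Longrightarrow> m i x \<noteq> 0 \<Longrightarrow> \<bar>s (Suc k) x - s k x\<bar> \<le> (1/2) ^ k"
      "\<And>i. i \<le> n k \<Longrightarrow> pairing (m i) (s (Suc k)) \<ge> pairing (m i) (s k) - e / 4 * (1/2) ^ Suc k" for k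
    using st(2)[of k] by (auto simp: Q_def s_def n_def split_beta)
  have n: "strict_mono n"
    using Q(1) by (rule strict_monoI_Suc)
  \<comment> \<open>Only here is convergence known: the increments are summable at a point as soon
    as some measure with this point in its support has been passed.\<close>
  define D where "D = insert base_pt (\<Union>i. {x. m i x \<noteq> 0})"
  have "\<exists>l. (\<lambda>k. s k x) \<longlonglongrightarrow> l" if x: "x \<in> D" for x
  proof (cases "x = base_pt")
    case True
    then show ?thesis
      using S[OF sS] by (auto intro!: exI[of _ 0])
  next
    case False
    then obtain i where i: "m i x \<noteq> 0"
      using x by (auto simp: D_def)
    have "norm (s (Suc k) x - s k x) \<le> (1/2) ^ k" if "k \<ge> i" for k
      using Q(3)[OF _ i] that seq_suble[OF n, of k] by simp
    then have "summable (\<lambda>k. s (Suc k) x - s k x)"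
      by (rule summable_comparison_test'[OF summable_geometric, rotated]) simp_all
    then have "convergent (\<lambda>k. s k x - s 0 x)"
      by (simp add: summable_iff_convergent sum_lessThan_telescope[of "\<lambda>k. s k x"])
    then obtain l where "(\<lambda>k. s k x - s 0 x) \<longlonglongrightarrow> l"
      by (auto simp: convergent_def)
    from tendsto_add[OF this tendsto_const[of "s 0 x"]] show ?thesis
      by auto
  qed
  then obtain F where F: "\<And>x. x \<in> D \<Longrightarrow> (\<lambda>k. s k x) \<longlonglongrightarrow> F x"
    by metis
  have DK: "D \<subseteq> K"
    using base supp by (auto simp: D_def)
  have "L-lipschitz_on D F"
  proof (rule lipschitz_onI)
    show "0 \<le> L"
      using S[OF zero] lipschitz_on_nonneg by blast
    fix x y assume xy: "x \<in> D" "y \<in> D"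
    have "dist (s k x) (s k y) \<le> L * dist x y" for k
      using S[OF sS] xy DK by (blast intro: lipschitz_onD)
    then show "dist (F x) (F y) \<le> L * dist x y"
      using tendsto_dist[OF F[OF xy(1)] F[OF xy(2)]] by (intro LIMSEQ_le_const2) auto
  qed
  then obtain G where G: "L-lipschitz_on UNIV G" "\<And>x. x \<in> D \<Longrightarrow> G x = F x"
    using mcshane_extension by (metis D_def insert_not_empty)
  have b: "base_pt \<in> D"
    by (simp add: D_def)
  have "F base_pt = 0"
    using F[OF b] S[OF sS] by (simp add: LIMSEQ_const_iff)
  then have "G base_pt = 0"
    using G(2)[OF b] by simp
  then have "(\<lambda>k. pairing (m k) G) \<longlonglongrightarrow> 0"
    using null G by blast
  then have "(\<lambda>k. pairing (m (n (Suc k))) G) \<longlonglongrightarrow> 0"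
    using LIMSEQ_subseq_LIMSEQ[OF _ n] LIMSEQ_Suc by (fastforce simp: o_def)
  moreover have "pairing (m (n (Suc k))) G \<ge> e / 2" for k
  proof -
    let ?i = "n (Suc k)"
    have "(\<lambda>j. pairing (m ?i) (s j)) \<longlonglongrightarrow> pairing (m ?i) G"
    proof (rule tendsto_pairing)
      fix x assume "m ?i x \<noteq> 0"
      then have "x \<in> D"
        by (auto simp: D_def)
      then show "(\<lambda>j. s j x) \<longlonglongrightarrow> G x"
        using F G(2) by simp
    qed
    \<comment> \<open>The term \<open>e / 4 * (1/2) ^ j\<close> pays for all losses after stage
      \<open>j\<close>, which lets the induction close.\<close>
    moreover have "pairing (m ?i) (s j) \<ge> e / 2 + e / 4 * (1/2) ^ j" if "j \<ge> Suc k" for j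
      using that
    proof (induction j rule: dec_induct)
      case base
      have "e / 4 * (1/2) ^ Suc k \<le> e / 4 * 1"
        using e by (intro mult_left_mono power_le_one) auto
      then show ?case
        using Q(2)[of k] by simp
    next
      case (step j)
      have "?i \<le> n j"
        using n step by (simp add: strict_mono_less_eq)
      from Q(4)[OF this] show ?case
        using step by (simp add: field_simps)
    qed
    then have "\<And>j. j \<ge> Suc k \<Longrightarrow> pairing (m ?i) (s j) \<ge> e / 2"
      using e by (smt (verit) divide_pos_pos mult_pos_pos zero_less_power)
    ultimately show ?thesis
      by (intro LIMSEQ_le_const) auto
  qed
  ultimately have "e / 2 \<le> 0"
    by (intro LIMSEQ_le_const) auto
  then show False
    using e by simp
qed

section \<open>Reduction to compact sets\<close>

text \<open>A growth bound: a \<open>C\<close>-Lipschitz function vanishing at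
  \<open>base_pt\<close> is at most \<open>C * radial x\<close> in absolute value. The summand 1
  allows division by it.\<close>

definition radial :: "'a::pointed_metric_space \<Rightarrow> real"
  where "radial x = 1 + dist x base_pt"

text \<open>Equal to 1 up to distance \<open>d * radial x\<close> from \<open>E\<close>, and to 0
  from twice that distance on. The width grows with \<open>radial\<close> so that multiplication
  preserves Lipschitz functions, which may be unbounded.\<close>

definition cutoff :: "'a::pointed_metric_space set \<Rightarrow> real \<Rightarrow> 'a \<Rightarrow> real"
  where "cutoff E d x = max 0 (min 1 (2 - infdist x E / (d * radial x)))"

lemma radial_pos: "radial x > 0"
  by (simp add: radial_def add_pos_nonneg)

lemma cutoff_range: "0 \<le> cutoff E d x" "cutoff E d x \<le> 1"
  by (auto simp: cutoff_def)

lemma cutoff_eq_1: "d > 0 \<Longrightarrow> infdist x E \<le> d * radial x \<Longrightarrow> cutoff E d x = 1"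
  using radial_pos[of x] by (simp add: cutoff_def divide_le_eq min_def)

lemma cutoff_neq_0D: "d > 0 \<Longrightarrow> cutoff E d x \<noteq> 0 \<Longrightarrow> infdist x E \<le> 2 * d * radial x"
proof -
  assume d: "d > 0" and "cutoff E d x \<noteq> 0"
  then have "infdist x E / (d * radial x) \<le> 2"
    by (auto simp: cutoff_def)
  then show ?thesis
    using d radial_pos[of x] by (simp add: divide_le_eq mult_ac)
qed

text \<open>The quotient \<open>r\<close> of \<open>infdist\<close> by \<open>radial\<close> is at
  most 1 because \<open>base_pt\<close> lies in \<open>E\<close>. Hence numerator and denominator
  each contribute at most \<open>dist x y\<close> to the weighted difference. The weight is there to
  absorb the growth of a factor \<open>f x\<close>.\<close>

lemma cutoff_slope:
  assumes "d > 0" "base_pt \<in> E"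
  shows "radial x * \<bar>cutoff E d x - cutoff E d y\<bar> \<le> 2 / d * dist x y"
proof -
  define r where "r z = infdist z E / radial z" for z
  have ry: "0 \<le> infdist y E" "infdist y E \<le> radial y"
    using infdist_le[OF assms(2), of y] by (auto simp: radial_def infdist_nonneg)
  have "radial x * (r x - r y) = (infdist x E - infdist y E) + r y * (radial y - radial x)"
    using radial_pos[of x] radial_pos[of y] by (simp add: r_def field_simps)
  also have "\<bar>\<dots>\<bar> \<le> \<bar>infdist x E - infdist y E\<bar> + \<bar>r y\<bar> * \<bar>radial y - radial x\<bar>"
    by (metis abs_mult abs_triangle_ineq)
  also have "\<dots> \<le> dist x y + 1 * dist x y"
  proof (intro add_mono mult_mono)
    show "\<bar>infdist x E - infdist y E\<bar> \<le> dist x y"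
      using infdist_triangle_abs[of x E y] by simp
    show "\<bar>r y\<bar> \<le> 1"
      using ry radial_pos[of y] by (simp add: r_def)
    show "\<bar>radial y - radial x\<bar> \<le> dist x y"
      unfolding radial_def using dist_triangle[of x base_pt y] dist_triangle[of y base_pt x] by (simp add: dist_commute abs_le_iff)
  qed auto
  finally have *: "radial x * \<bar>r x - r y\<bar> \<le> 2 * dist x y"
    using radial_pos[of x] by (simp add: abs_mult)
  have "\<bar>cutoff E d x - cutoff E d y\<bar> \<le> \<bar>(2 - r x / d) - (2 - r y / d)\<bar>"
    unfolding cutoff_def r_def by (simp add: mult.commute[of d] max_def min_def)
  also have "\<dots> = \<bar>r x - r y\<bar> / d"
    using assms(1) by (simp add: abs_minus_commute flip: diff_divide_distrib)
  finally have "radial x * \<bar>cutoff E d x - cutoff E d y\<bar> \<le> radial x * (\<bar>r x - r y\<bar> / d)"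
    using radial_pos[of x] by (intro mult_left_mono) auto
  also have "\<dots> \<le> 2 * dist x y / d"
    using * assms(1) by (simp add: divide_right_mono)
  finally show ?thesis
    by simp
qed

lemma cutoff_mult_lipschitz:
  assumes f: "C-lipschitz_on UNIV f" "f base_pt = 0" and d: "d > 0" "base_pt \<in> E"
  shows "(C * (1 + 2 / d))-lipschitz_on UNIV (\<lambda>x. cutoff E d x * f x)"
proof (rule lipschitz_onI)
  have C: "C \<ge> 0"
    using f(1) by (rule lipschitz_on_nonneg)
  then show "0 \<le> C * (1 + 2 / d)"
    using d by simp
  fix x y
  have fx: "\<bar>f x\<bar> \<le> C * radial x"
  proof -
    have "\<bar>f x\<bar> \<le> C * dist x base_pt"
      using lipschitz_onD[OF f(1), of x base_pt] f(2) by (simp add: dist_real_def)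
    also have "\<dots> \<le> C * radial x"
      using C by (intro mult_left_mono) (auto simp: radial_def)
    finally show ?thesis .
  qed
  have "cutoff E d x * f x - cutoff E d y * f y =
      f x * (cutoff E d x - cutoff E d y) + cutoff E d y * (f x - f y)"
    by (simp add: algebra_simps)
  also have "\<bar>\<dots>\<bar> \<le> \<bar>f x\<bar> * \<bar>cutoff E d x - cutoff E d y\<bar> + cutoff E d y * \<bar>f x - f y\<bar>"
    using abs_triangle_ineq cutoff_range(1)[of E d y] by (metis abs_mult abs_of_nonneg)
  also have "\<dots> \<le> (C * radial x) * \<bar>cutoff E d x - cutoff E d y\<bar> + 1 * (C * dist x y)"
    using fx cutoff_range[of E d y] lipschitz_onD[OF f(1), of x y]
    by (intro add_mono mult_mono) (auto simp: dist_real_def)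
  also have "\<dots> \<le> C * (2 / d * dist x y) + C * dist x y"
    using mult_left_mono[OF cutoff_slope[OF d, of x y] C] by (simp add: mult_ac)
  finally show "dist (cutoff E d x * f x) (cutoff E d y * f y) \<le> C * (1 + 2 / d) * dist x y"
    by (simp add: dist_real_def algebra_simps)
qed

section \<open>Tightness: concentration near finite sets\<close>

text \<open>If no finite set works, each finite set leaves a measure that pairs to more than
  \<open>e\<close> with a function vanishing near the set. Cutting such functions off around the
  support of their measure gives humps with disjoint supports for
  \<open>gliding_hump\<close>.\<close>

lemma weakly_null_meas_tight_aux:
  fixes m :: "nat \<Rightarrow> 'a::pointed_metric_space \<Rightarrow> real"
  assumes m: "weakly_null_meas m" and d: "d > 0" and e: "e > 0"
  shows "\<exists>E. finite E \<and> base_pt \<in> E \<and> (\<forall>n f. 1-lipschitz_on UNIV f \<longrightarrow>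
    (\<forall>x. infdist x E \<le> d * radial x \<longrightarrow> f x = 0) \<longrightarrow> pairing (m n) f \<le> e)"
proof (rule ccontr)
  assume neg: "\<not> ?thesis"
  have bad: "\<exists>n f. 1-lipschitz_on UNIV f \<and> (\<forall>x. infdist x E \<le> d * radial x \<longrightarrow> f x = 0) \<and> pairing (m n) f > e"
    if "finite E" "base_pt \<in> E" for E
    using neg that by (meson not_le)
  have fin: "finite {x. m n x \<noteq> 0}" for n
    using m by (simp add: weakly_null_meas_def)
  \<comment> \<open>The constant of \<open>cutoff_mult_lipschitz\<close> for a 1-Lipschitz function
    and the cutoff at scale \<open>d / 2\<close>.\<close>
  define C where "C = 1 + 4 / d"
  have C: "C \<ge> 0"
    using d by (simp add: C_def)
  \<comment> \<open>Sums of \<open>C\<close>-Lipschitz functions with disjoint supports: the second and third clauses survive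
    the addition of another one, as at most one summand is nonzero at each of the two points.\<close>
  define S :: "('a \<Rightarrow> real) set" where "S = {s. \<exists>E. finite E \<and> base_pt \<in> E \<and> s base_pt = 0 \<and>
      (\<forall>x. s x \<noteq> 0 \<longrightarrow> infdist x E \<le> d * radial x) \<and>
      (\<forall>x y. \<bar>s x - s y\<bar> \<le> 2 * C * dist x y) \<and> (\<forall>x y. s y = 0 \<longrightarrow> \<bar>s x - s y\<bar> \<le> C * dist x y)}"
  show False
  proof (rule gliding_hump[OF m _ UNIV_I e, of S "2 * C"])
    show "(\<lambda>_. 0) \<in> S"
      using C by (auto simp: S_def intro: exI[of _ "{base_pt}"])
    show "s base_pt = 0 \<and> (2 * C)-lipschitz_on UNIV s" if "s \<in> S" for s
      using that C by (auto simp: S_def dist_real_def intro!: lipschitz_onI)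
    fix s and E1 :: "'a set" and N and r :: real
    assume "s \<in> S" and E1: "finite E1" and r: "r > 0"
    then obtain E0 where E0: "finite E0" "base_pt \<in> E0" and s0: "s base_pt = 0"
      and s1: "\<And>x. s x \<noteq> 0 \<Longrightarrow> infdist x E0 \<le> d * radial x"
      and s2: "\<And>x y. \<bar>s x - s y\<bar> \<le> 2 * C * dist x y"
      and s3: "\<And>x y. s y = 0 \<Longrightarrow> \<bar>s x - s y\<bar> \<le> C * dist x y"
      unfolding S_def by blast
    \<comment> \<open>Vanishing near \<open>E0\<close> separates the new hump from \<open>s\<close>,
      vanishing on \<open>E1\<close> gives the smallness, and vanishing on the supports of the first
      \<open>N\<close> measures forces \<open>n \<ge> N\<close>.\<close>
    define E where "E = E0 \<union> E1 \<union> (\<Union>n<N. {x. m n x \<noteq> 0})"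
    have E: "finite E" "base_pt \<in> E"
      using E0 E1 fin by (auto simp: E_def)
    then obtain n f where f: "1-lipschitz_on UNIV f" "\<And>x. infdist x E \<le> d * radial x \<Longrightarrow> f x = 0"
      and n: "pairing (m n) f > e"
      using bad by blast
    have fE: "f x = 0" if "x \<in> E" for x
      using f(2)[of x] that d radial_pos[of x] by simp
    have "n \<ge> N"
    proof (rule ccontr)
      assume "\<not> n \<ge> N"
      then have "pairing (m n) f = pairing (m n) (\<lambda>_. 0)"
        using fE by (intro pairing_cong) (force simp: E_def)
      then show False
        using n e by (simp add: pairing_def)
    qed
    define E' where "E' = E \<union> {x. m n x \<noteq> 0}"
    have E': "finite E'" "base_pt \<in> E'"
      using E fin by (auto simp: E'_def)
    \<comment> \<open>The cutoff is 1 on the support of \<open>m n\<close>, so the pairing is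
      unchanged. Scale \<open>d / 2\<close> keeps the support within distance
      \<open>d * radial x\<close> of \<open>E'\<close>, as \<open>S\<close> demands.\<close>
    define h where "h x = cutoff E' (d/2) x * f x" for x
    have h: "\<bar>h x - h y\<bar> \<le> C * dist x y" for x y
      using lipschitz_onD[OF cutoff_mult_lipschitz[OF f(1) fE[OF E(2)] _ E'(2), of "d/2"], of x y] d
      by (simp add: h_def C_def dist_real_def)
    have disj: "s x = 0 \<or> h x = 0" for x
    proof (rule ccontr)
      assume "\<not> ?thesis"
      then have "infdist x E0 \<le> d * radial x" "f x \<noteq> 0"
        using s1[of x] by (auto simp: h_def)
      moreover have "infdist x E \<le> infdist x E0"
        using E0 by (intro infdist_mono) (auto simp: E_def)
      ultimately show False
        using f(2)[of x] by simp
    qed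
    have supp: "infdist x E' \<le> d * radial x" if "s x + h x \<noteq> 0" for x
    proof (cases "s x = 0")
      case True
      then show ?thesis
        using that cutoff_neq_0D[of "d/2" E' x] d by (auto simp: h_def)
    next
      case False
      have "infdist x E' \<le> infdist x E0"
        using E0 by (intro infdist_mono) (auto simp: E_def E'_def)
      then show ?thesis
        using s1[OF False] by simp
    qed
    have h0: "h x = 0" if "x \<in> E" for x
      using fE[OF that] by (simp add: h_def)
    have lip: "\<bar>s x + h x - (s y + h y)\<bar> \<le> 2 * C * dist x y" for x y
      using disj[of x] disj[of y] s2[of x y] h[of x y] s3[of x y] s3[of y x] C
      by (auto simp: dist_commute[of y x] abs_le_iff)
    have lip0: "\<bar>s x + h x - (s y + h y)\<bar> \<le> C * dist x y" if "s y + h y = 0" for x y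
      using disj[of x] disj[of y] that s3[of y x] h[of x y] by auto
    have "(\<lambda>x. s x + h x) \<in> S"
      unfolding S_def using E' s0 h0[OF E(2)] supp lip lip0
      by (intro CollectI exI[of _ E']) auto
    moreover have "pairing (m n) h = pairing (m n) f"
    proof (rule pairing_cong)
      fix x assume "m n x \<noteq> 0"
      then have "cutoff E' (d/2) x = 1"
        using d radial_pos[of x] by (intro cutoff_eq_1) (auto simp: E'_def)
      then show "h x = f x"
        by (simp add: h_def)
    qed
    moreover have "\<forall>x\<in>E1. \<bar>h x\<bar> \<le> r"
      using h0 r by (auto simp: E_def)
    ultimately show "\<exists>n\<ge>N. \<exists>h. (\<lambda>x. s x + h x) \<in> S \<and> (\<forall>x\<in>E1. \<bar>h x\<bar> \<le> r) \<and> e \<le> pairing (m n) h"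
      using n \<open>n \<ge> N\<close> by (intro exI[of _ n] exI[of _ h] conjI) auto
  qed auto
qed

text \<open>The part of \<open>f\<close> removed by the cutoff vanishes near \<open>E\<close> and is
  \<open>c\<close>-Lipschitz, so the one-sided bound applies after division by \<open>c\<close>;
  using it for \<open>f\<close> and \<open>- f\<close> gives the absolute value.\<close>

lemma weakly_null_meas_tight:
  fixes m :: "nat \<Rightarrow> 'a::pointed_metric_space \<Rightarrow> real"
  assumes m: "weakly_null_meas m" and d: "d > 0" and e: "e > 0"
  shows "\<exists>E. finite E \<and> base_pt \<in> E \<and> (\<forall>n f. 1-lipschitz_on UNIV f \<longrightarrow> f base_pt = 0 \<longrightarrow>
    \<bar>pairing (m n) f - pairing (m n) (\<lambda>x. cutoff E d x * f x)\<bar> \<le> e)"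
proof -
  define c where "c = 2 + 2 / d"
  have c: "c > 0"
    using d by (simp add: c_def add_pos_pos)
  obtain E where E: "finite E" "base_pt \<in> E"
    and small: "\<And>n f. 1-lipschitz_on UNIV f \<Longrightarrow> (\<And>x. infdist x E \<le> d * radial x \<Longrightarrow> f x = 0) \<Longrightarrow>
      pairing (m n) f \<le> e / c"
    using weakly_null_meas_tight_aux[OF m d, of "e / c"] e c by (auto; blast)
  have le: "pairing (m n) f - pairing (m n) (\<lambda>x. cutoff E d x * f x) \<le> e"
    if f: "1-lipschitz_on UNIV f" "f base_pt = 0" for f n
  proof -
    define g where "g x = (1 / c) * (f x - cutoff E d x * f x)" for x
    have "(\<bar>1 / c\<bar> * (1 + 1 * (1 + 2 / d)))-lipschitz_on UNIV g"
      unfolding g_def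
      by (intro lipschitz_on_cmult_real lipschitz_on_diff cutoff_mult_lipschitz f d E)
    moreover have "\<bar>1 / c\<bar> * (1 + 1 * (1 + 2 / d)) = 1"
      using c by (simp add: c_def)
    ultimately have "1-lipschitz_on UNIV g"
      by metis
    moreover have "g x = 0" if "infdist x E \<le> d * radial x" for x
      using cutoff_eq_1[OF d that] by (simp add: g_def)
    ultimately have "pairing (m n) g \<le> e / c"
      by (rule small)
    then show ?thesis
      using c unfolding g_def pairing_cmult pairing_diff by (simp add: divide_le_cancel)
  qed
  have "\<bar>pairing (m n) f - pairing (m n) (\<lambda>x. cutoff E d x * f x)\<bar> \<le> e"
    if f: "1-lipschitz_on UNIV f" "f base_pt = 0" for f n
    using le[OF f, of n] le[of "\<lambda>x. - f x" n] f by (simp add: pairing_uminus abs_le_iff)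
  then show ?thesis
    using E by blast
qed

text \<open>For \<open>k = 0\<close> the factor of \<open>radial x\<close> is \<open>1 / 4\<close>,
  and being less than 1 it bounds \<open>radial\<close> on the set. The distances to the finite sets
  \<open>E k\<close> then tend to zero uniformly, so the set is totally bounded; it is also closed
  in a complete space.\<close>

lemma compact_cutoff_limit:
  fixes E :: "nat \<Rightarrow> 'a::{pointed_metric_space, complete_space} set"
  assumes E: "\<And>k. finite (E k)" "\<And>k. base_pt \<in> E k"
  shows "compact {x. \<forall>k. infdist x (E k) \<le> 2 * (1/2) ^ (k + 3) * radial x}" (is "compact ?K")
  unfolding compact_eq_totally_bounded
proof (intro conjI allI impI)
  have "closed ?K"
    unfolding radial_def by (intro closed_Collect_all closed_Collect_le continuous_intros)
  then show "complete ?K"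
    by (simp add: complete_eq_closed)
  obtain R where R: "\<And>y. y \<in> E 0 \<Longrightarrow> dist y base_pt \<le> R"
    using finite_imp_bounded[OF E(1)[of 0]] by (metis bounded_any_center dist_commute)
  have near: "\<exists>y\<in>E k. dist x y \<le> 2 * (1/2) ^ (k + 3) * radial x" if "x \<in> ?K" for x k
  proof -
    have "infdist x (E k) = Min (dist x ` E k)"
      using E by (subst infdist_notempty) (auto intro!: cInf_eq_Min)
    also have "\<dots> \<in> dist x ` E k"
      using E by (intro Min_in) auto
    finally obtain y where "y \<in> E k" "infdist x (E k) = dist x y"
      by blast
    moreover have "infdist x (E k) \<le> 2 * (1/2) ^ (k + 3) * radial x"
      using that by blast
    ultimately show ?thesis
      by (metis (no_types))
  qed
  have bd: "radial x \<le> 2 * (1 + R)" if x: "x \<in> ?K" for x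
  proof -
    obtain y where y: "y \<in> E 0" "dist x y \<le> 2 * (1/2) ^ (0 + 3) * radial x"
      using near[OF x] by blast
    have "radial x \<le> 1 + R + dist x y"
      using R[OF y(1)] dist_triangle[of x base_pt y] by (simp add: radial_def)
    then have "radial x \<le> 1 + R + radial x / 4"
      using y(2) by (simp add: power3_eq_cube)
    then show ?thesis
      using radial_pos[of x] by simp
  qed
  have R0: "R \<ge> 0"
    using R[OF E(2)] by simp
  fix e :: real assume e: "e > 0"
  obtain k where k: "(1/2) ^ k < e / (1 + R)"
    using real_arch_pow_inv[of "e / (1 + R)" "1/2"] e R0 by auto
  have "?K \<subseteq> (\<Union>y\<in>E k. ball y e)"
  proof
    fix x assume x: "x \<in> ?K"
    obtain y where y: "y \<in> E k" "dist x y \<le> 2 * (1/2) ^ (k + 3) * radial x"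
      using near[OF x] by blast
    note y(2)
    also have "2 * (1/2) ^ (k + 3) * radial x \<le> 2 * (1/2) ^ (k + 3) * (2 * (1 + R))"
      using bd[OF x] by (intro mult_left_mono) auto
    also have "\<dots> = (1/2) ^ k * (1 + R) / 2"
      by (simp add: power_add power3_eq_cube)
    also have "\<dots> \<le> (1/2) ^ k * (1 + R)"
      using R0 by simp
    also have "\<dots> < e"
      using k R0 by (simp add: field_simps)
    finally show "x \<in> (\<Union>y\<in>E k. ball y e)"
      using y(1) by (auto simp: dist_commute)
  qed
  then show "\<exists>k. finite k \<and> ?K \<subseteq> (\<Union>x\<in>k. ball x e)"
    using E(1) by blast
qed

section \<open>Measures on countable compact sets\<close>

text \<open>Subtracting from \<open>t\<close> the measure of the part below \<open>t\<close> of a small open cover of \<open>A\<close>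
  flattens the identity near \<open>A\<close>.\<close>

lemma flattening_function:
  fixes A :: "real set"
  assumes A: "countable A" and e: "e > 0"
  obtains p :: "real \<Rightarrow> real" and U where "1-lipschitz_on UNIV p" "p 0 = 0" "\<And>t. \<bar>p t - t\<bar> \<le> e"
    "open U" "A \<subseteq> U" "\<And>s t. s \<le> t \<Longrightarrow> {s..t} \<subseteq> U \<Longrightarrow> p s = p t"
proof -
  \<comment> \<open>A countable set is null, so outer regularity encloses it in an open set of
    measure less than \<open>e\<close>.\<close>
  have "negligible A"
    using countable_imp_null_set_lborel[OF A] by (simp add: negligible_iff_null_sets null_sets_completionI)
  then have A0: "A \<in> null_sets lebesgue"
    by (simp add: negligible_iff_null_sets)
  obtain U where U: "open U" "A \<subseteq> U" "emeasure lebesgue (U - A) < ennreal e"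
    using sets_lebesgue_outer_open[OF null_setsD2[OF A0] e] by metis
  then have "emeasure lebesgue U < ennreal e"
    using emeasure_Diff_null_set[OF A0, of U] by simp
  then have U': "U \<in> lmeasurable" "measure lebesgue U < e"
    using U(1) e by (simp_all add: fmeasurable_def measure_def enn2real_less_iff order_less_trans[OF _ ennreal_less_top])
  \<comment> \<open>\<open>q\<close> is nondecreasing, 1-Lipschitz, with values in
    \<open>[0, e]\<close>, and has slope exactly 1 along intervals inside \<open>U\<close>. So
    \<open>t - q t\<close> is constant on these.\<close>
  define q where "q t = measure lebesgue (U \<inter> {..t})" for t
  have meas: "U \<inter> B \<in> lmeasurable" if "B \<in> sets borel" for B
    using U' that by (intro fmeasurable_Int_fmeasurable) auto
  have q_diff: "q t - q s = measure lebesgue (U \<inter> {s<..t})" if "s \<le> t" for s t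
  proof -
    have "q t = measure lebesgue ((U \<inter> {..s}) \<union> (U \<inter> {s<..t}))"
      unfolding q_def using that by (intro arg_cong[of _ _ "measure lebesgue"]) auto
    also have "\<dots> = q s + measure lebesgue (U \<inter> {s<..t})"
      unfolding q_def by (intro measure_Un_AE AE_I2) (auto intro: meas fmeasurableD)
    finally show ?thesis
      by simp
  qed
  have q_bound: "0 \<le> q t" "q t \<le> e" for t
    using U' measure_mono_fmeasurable[of "U \<inter> {..t}" U lebesgue] meas[of "{..t}"]
    by (auto simp: q_def)
  have q_mono: "0 \<le> q t - q s" "q t - q s \<le> t - s" if "s \<le> t" for s t
  proof -
    have "measure lebesgue (U \<inter> {s<..t}) \<le> measure lebesgue {s<..t}"
      using meas[of "{s<..t}"]
      by (intro measure_mono_fmeasurable bounded_set_imp_lmeasurable) auto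
    then show "0 \<le> q t - q s" "q t - q s \<le> t - s"
      using that by (auto simp: q_diff)
  qed
  define p where "p t = t - q t + q 0" for t
  show thesis
  proof (rule that)
    have "dist (p s) (p t) \<le> 1 * dist s t" for s t
      using q_mono[of s t] q_mono[of t s] by (cases "s \<le> t") (auto simp: p_def dist_real_def)
    then show "1-lipschitz_on UNIV p"
      by (intro lipschitz_onI) auto
    show "p 0 = 0"
      by (simp add: p_def)
    show "\<bar>p t - t\<bar> \<le> e" for t
      using q_bound[of t] q_bound[of 0] by (simp add: p_def)
    show "p s = p t" if "s \<le> t" "{s..t} \<subseteq> U" for s t
    proof -
      have "U \<inter> {s<..t} = {s<..t}"
        using that by auto
      then show ?thesis
        using q_diff[OF that(1)] that(1) by (simp add: p_def)
    qed
  qed (use U in auto)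
qed

text \<open>Rounding the values on a finite \<open>e / 3\<close>-net \<open>P\<close> to multiples
  of \<open>e / 3\<close> leaves finitely many patterns, and functions with equal patterns differ by
  at most \<open>e\<close> on \<open>K\<close>. One member of \<open>F\<close> is kept for each
  pattern, so the net consists of test functions.\<close>

lemma finite_uniform_net:
  fixes K :: "'a::pointed_metric_space set" and F :: "('a \<Rightarrow> real) set"
  assumes K: "compact K" "base_pt \<in> K" and e: "e > 0"
    and F: "\<And>f. f \<in> F \<Longrightarrow> 1-lipschitz_on UNIV f \<and> f base_pt = 0"
  obtains H where "finite H" "H \<subseteq> F" "\<And>f. f \<in> F \<Longrightarrow> \<exists>h\<in>H. \<forall>x\<in>K. \<bar>f x - h x\<bar> \<le> e"
proof -
  obtain P where P: "finite P" "K \<subseteq> (\<Union>x\<in>P. ball x (e/3))"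
    using K(1) e unfolding compact_eq_totally_bounded by (metis zero_less_divide_iff zero_less_numeral)
  obtain R where R: "\<And>x. x \<in> P \<Longrightarrow> dist x base_pt \<le> R"
    using finite_imp_bounded[OF P(1)] by (metis bounded_any_center dist_commute)
  define q :: "('a \<Rightarrow> real) \<Rightarrow> 'a \<Rightarrow> int" where "q f = restrict (\<lambda>x. \<lfloor>f x / (e/3)\<rfloor>) P" for f
  define B where "B = {\<lfloor>- R / (e/3)\<rfloor> .. \<lfloor>R / (e/3)\<rfloor>}"
  have "q f \<in> P \<rightarrow>\<^sub>E B" if "f \<in> F" for f
  proof -
    have "\<lfloor>f x / (e/3)\<rfloor> \<in> B" if "x \<in> P" for x
    proof -
      have "\<bar>f x\<bar> \<le> R"
        using lipschitz_onD[of 1 UNIV f x base_pt] F[OF \<open>f \<in> F\<close>] R[OF that] by (simp add: dist_real_def)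
      then have "- R / (e/3) \<le> f x / (e/3)" "f x / (e/3) \<le> R / (e/3)"
        using e by (intro divide_right_mono; simp)+
      then show ?thesis
        unfolding B_def by (auto intro!: floor_mono simp del: divide_divide_eq_right)
    qed
    then show ?thesis
      by (auto simp: q_def)
  qed
  then have "finite (q ` F)"
    using P(1) by (intro finite_subset[OF _ finite_PiE[of P "\<lambda>_. B"]]) (auto simp: B_def)
  then obtain H where H: "H \<subseteq> F" "finite H" "q ` F = q ` H"
    using finite_subset_image[of "q ` F" q F] by auto
  show thesis
  proof (rule that[OF H(2,1)])
    fix f assume f: "f \<in> F"
    then obtain h where h: "h \<in> H" "q f = q h"
      using H(3) by (metis imageE imageI)
    have "\<bar>f x - h x\<bar> \<le> e" if x: "x \<in> K" for x
    proof -
      obtain y where y: "y \<in> P" "dist y x < e/3"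
        using P(2) x by auto
      have "\<lfloor>f y / (e/3)\<rfloor> = \<lfloor>h y / (e/3)\<rfloor>"
        using fun_cong[OF h(2), of y] y(1) by (simp add: q_def)
      then have "f y / (e/3) - h y / (e/3) < 1" "h y / (e/3) - f y / (e/3) < 1"
        by linarith+
      then have "f y - h y < e/3" "h y - f y < e/3"
        using e by (simp_all add: field_simps)
      moreover have "\<bar>f y - f x\<bar> \<le> dist y x" "\<bar>h y - h x\<bar> \<le> dist y x"
        using lipschitz_onD[of 1 UNIV f y x] lipschitz_onD[of 1 UNIV h y x] F[OF f] F[of h] h(1) H(1)
        by (auto simp: dist_real_def)
      ultimately show ?thesis
        using y(2) by linarith
    qed
    then show "\<exists>h\<in>H. \<forall>x\<in>K. \<bar>f x - h x\<bar> \<le> e"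
      using h(1) by blast
  qed
qed

text \<open>The image of \<open>K\<close> under \<open>g\<close> is countable; flattening the line
  near it makes \<open>g\<close> constant around each point of \<open>K\<close>, and a Lebesgue
  number makes the scale uniform. Zeros are kept, in particular the one at
  \<open>base_pt\<close>.\<close>

lemma locally_constant_approx:
  fixes K :: "'a::metric_space set" and g :: "'a \<Rightarrow> real"
  assumes K: "compact K" "countable K" and e: "e > 0" and g: "C-lipschitz_on UNIV g"
  obtains h d where "C-lipschitz_on UNIV h" "\<And>x. g x = 0 \<Longrightarrow> h x = 0" "\<And>x. \<bar>h x - g x\<bar> \<le> e"
    "d > 0" "\<And>x y. x \<in> K \<Longrightarrow> y \<in> K \<Longrightarrow> dist x y < d \<Longrightarrow> h x = h y"
proof -
  obtain p :: "real \<Rightarrow> real" and U where p: "1-lipschitz_on UNIV p" "p 0 = 0" "\<And>t. \<bar>p t - t\<bar> \<le> e"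
    and U: "open U" "g ` K \<subseteq> U" "\<And>s t. s \<le> t \<Longrightarrow> {s..t} \<subseteq> U \<Longrightarrow> p s = p t"
    using flattening_function[OF countable_image[OF K(2), of g] e] by metis
  have cont: "continuous_on UNIV g"
    using g by (rule lipschitz_on_continuous_on)
  have "\<exists>B. x \<in> B \<and> open B \<and> (\<forall>y\<in>B. \<forall>z\<in>B. p (g y) = p (g z))" if x: "x \<in> K" for x
  proof -
    obtain r where r: "r > 0" "ball (g x) r \<subseteq> U"
      using openE[OF U(1), of "g x"] U(2) x by blast
    have eq: "p s = p t" if "s \<in> ball (g x) r" "t \<in> ball (g x) r" "s \<le> t" for s t
    proof (rule U(3)[OF that(3)])
      show "{s..t} \<subseteq> U"
        using that r(2) by (auto simp: dist_real_def subset_iff)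
    qed
    have "p s = p t" if "s \<in> ball (g x) r" "t \<in> ball (g x) r" for s t
      using eq[of s t] eq[of t s] that by (metis linear)
    moreover have "x \<in> g -` ball (g x) r" "open (g -` ball (g x) r)"
      using r(1) cont by (auto intro: open_vimage)
    ultimately show ?thesis
      by blast
  qed
  then obtain B where B: "\<And>x. x \<in> K \<Longrightarrow> x \<in> B x" "\<And>x. x \<in> K \<Longrightarrow> open (B x)"
      "\<And>x y z. x \<in> K \<Longrightarrow> y \<in> B x \<Longrightarrow> z \<in> B x \<Longrightarrow> p (g y) = p (g z)"
    by metis
  have "\<exists>d>0. \<forall>x\<in>K. \<forall>y\<in>K. dist x y < d \<longrightarrow> p (g x) = p (g y)"
  proof (cases "K = {}")
    case False
    then have cover: "B ` K \<noteq> {}" "K \<subseteq> \<Union>(B ` K)" "\<And>A. A \<in> B ` K \<Longrightarrow> open A"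
      using B(1,2) by auto
    obtain d where d: "d > 0" "\<And>T. T \<subseteq> K \<Longrightarrow> diameter T < d \<Longrightarrow> \<exists>A\<in>B ` K. T \<subseteq> A"
      using Lebesgue_number_lemma[OF K(1) cover] by metis
    have "p (g x) = p (g y)" if xy: "x \<in> K" "y \<in> K" "dist x y < d" for x y
    proof -
      have "diameter {x, y} < d"
        using xy(3) d(1) by (simp add: diameter_def dist_commute cSup_eq_Max)
      then obtain z where "z \<in> K" "{x, y} \<subseteq> B z"
        using d(2)[of "{x, y}"] xy by auto
      then show ?thesis
        using B(3) by blast
    qed
    then show ?thesis
      using d(1) by blast
  qed (auto intro: exI[of _ 1])
  then obtain d where d: "d > 0" "\<And>x y. x \<in> K \<Longrightarrow> y \<in> K \<Longrightarrow> dist x y < d \<Longrightarrow> p (g x) = p (g y)"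
    by blast
  show thesis
  proof (rule that[of "\<lambda>x. p (g x)" d])
    have "(1 * C)-lipschitz_on UNIV (\<lambda>x. p (g x))"
      by (rule lipschitz_on_compose2[OF g lipschitz_on_subset[OF p(1)]]) auto
    then show "C-lipschitz_on UNIV (\<lambda>x. p (g x))"
      by simp
    show "p (g x) = 0" if "g x = 0" for x
      using p(2) that by simp
  qed (fact p(3) d)+
qed

text \<open>Otherwise arbitrarily late measures pair well with some function \<open>f\<close>.
  Subtracting a nearby member of a finite net, on which late measures are small, leaves a hump of
  small sup norm on \<open>K\<close>. Flattened, it can be added to the earlier sum at little cost
  in the Lipschitz constant.\<close>

lemma weakly_null_meas_countable_compact:
  fixes m :: "nat \<Rightarrow> 'a::pointed_metric_space \<Rightarrow> real"
  assumes m: "weakly_null_meas m" and supp: "\<And>n x. m n x \<noteq> 0 \<Longrightarrow> x \<in> K"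
    and K: "compact K" "countable K" "base_pt \<in> K" and e: "e > 0"
  shows "\<forall>\<^sub>F n in sequentially. \<forall>f. 1-lipschitz_on UNIV f \<longrightarrow> f base_pt = 0 \<longrightarrow> pairing (m n) f \<le> e"
proof (rule ccontr)
  assume neg: "\<not> ?thesis"
  have bad: "\<exists>n\<ge>N. \<exists>f. 1-lipschitz_on UNIV f \<and> f base_pt = 0 \<and> pairing (m n) f > e" for N
    using neg by (auto simp: eventually_sequentially not_le)
  have null: "(\<lambda>n. pairing (m n) f) \<longlonglongrightarrow> 0" if "C-lipschitz_on UNIV f" "f base_pt = 0" for f C
    using m that by (auto simp: weakly_null_meas_def)
  define F :: "('a \<Rightarrow> real) set" where "F = {f. 1-lipschitz_on UNIV f \<and> f base_pt = 0}"
  \<comment> \<open>\<open>L < 4\<close> leaves room for one more hump. \<open>2 \<le> L\<close>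
    covers close pairs of points, where \<open>s\<close> is constant and only the 2-Lipschitz hump
    varies.\<close>
  define S :: "('a \<Rightarrow> real) set" where "S = {s. s base_pt = 0 \<and>
      (\<exists>L<4. 2 \<le> L \<and> L-lipschitz_on K s) \<and> (\<exists>d>0. \<forall>x\<in>K. \<forall>y\<in>K. dist x y < d \<longrightarrow> s x = s y)}"
  show False
  proof (rule gliding_hump[OF m supp K(3), where e = "e/2" and S = S and L = 4])
    show "(\<lambda>_. 0) \<in> S"
    proof -
      have "2-lipschitz_on K (\<lambda>_. 0 :: real)"
        by (rule lipschitz_onI) auto
      moreover have "(2::real) < 4" "(2::real) \<le> 2" "(1::real) > 0"
        by simp_all
      ultimately show ?thesis
        unfolding S_def by blast
    qed
    show "s base_pt = 0 \<and> 4-lipschitz_on K s" if s: "s \<in> S" for s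
    proof -
      obtain L where "s base_pt = 0" "L < 4" "L-lipschitz_on K s"
        using s unfolding S_def by blast
      then show ?thesis
        using lipschitz_on_mono[OF _ order_refl, of L K s 4] by simp
    qed
    fix s and E :: "'a set" and N and r :: real
    assume s: "s \<in> S" and E: "E \<subseteq> K" and r: "r > 0"
    obtain L d where s0: "s base_pt = 0" and L: "L < 4" "2 \<le> L" "L-lipschitz_on K s"
      and d: "d > 0" "\<And>x y. x \<in> K \<Longrightarrow> y \<in> K \<Longrightarrow> dist x y < d \<Longrightarrow> s x = s y"
      using s unfolding S_def by blast
    \<comment> \<open>At distance at least \<open>d\<close>, a hump bounded by \<open>c\<close> adds
      at most \<open>2 * c / d \<le> (4 - L) / 2\<close> to the Lipschitz constant, half of the
      remaining room.\<close>
    define c where "c = min r ((4 - L) * d / 4)"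
    have c: "c > 0" "c \<le> r" "2 * c \<le> (4 - L) * d / 2"
      using r L(1) d(1) by (auto simp: c_def)
    obtain H where H: "finite H" "H \<subseteq> F" "\<And>f. f \<in> F \<Longrightarrow> \<exists>h\<in>H. \<forall>x\<in>K. \<bar>f x - h x\<bar> \<le> c / 2"
      using finite_uniform_net[OF K(1,3), of "c / 2" F] c(1) by (auto simp: F_def)
    have "\<forall>h\<in>H. \<forall>\<^sub>F n in sequentially. \<bar>pairing (m n) h\<bar> < e / 4"
    proof
      fix h assume "h \<in> H"
      then have "(\<lambda>n. pairing (m n) h) \<longlonglongrightarrow> 0"
        using H(2) null by (auto simp: F_def)
      then show "\<forall>\<^sub>F n in sequentially. \<bar>pairing (m n) h\<bar> < e / 4"
        using e by (auto simp: tendsto_iff dest!: spec[of _ "e/4"])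
    qed
    then have "\<forall>\<^sub>F n in sequentially. \<forall>h\<in>H. \<bar>pairing (m n) h\<bar> < e / 4"
      by (rule eventually_ball_finite[OF H(1)])
    then obtain N' where N': "\<And>n h. n \<ge> N' \<Longrightarrow> h \<in> H \<Longrightarrow> \<bar>pairing (m n) h\<bar> < e / 4"
      by (auto simp: eventually_sequentially)
    obtain n f where n: "n \<ge> max N N'" and f: "f \<in> F" "pairing (m n) f > e"
      using bad unfolding F_def by blast
    obtain h0 where h0: "h0 \<in> H" "\<And>x. x \<in> K \<Longrightarrow> \<bar>f x - h0 x\<bar> \<le> c / 2"
      using H(3)[OF f(1)] by blast
    define g where "g x = f x - h0 x" for x
    have "(1 + 1)-lipschitz_on UNIV g"
      unfolding g_def using f(1) h0(1) H(2) by (intro lipschitz_on_diff) (auto simp: F_def)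
    then have g: "2-lipschitz_on UNIV g"
      by simp
    have gn: "pairing (m n) g > 3 * e / 4"
      using f(2) N'[of n h0] n h0(1) by (simp add: g_def[abs_def] pairing_diff abs_less_iff)
    define M where "M = (\<Sum>x | m n x \<noteq> 0. \<bar>m n x\<bar>)"
    have M: "M \<ge> 0"
      by (auto simp: M_def intro: sum_nonneg)
    \<comment> \<open>Flattening may cost \<open>c / 2\<close> in sup norm and \<open>e / 4\<close>
      in the pairing with \<open>m n\<close>. The second bound depends on the total mass
      \<open>M\<close>, so the flattening comes after the choice of \<open>n\<close>.\<close>
    define t where "t = min (c / 2) (e / 4 / (M + 1))"
    have t: "t > 0"
      using c(1) e M by (simp add: t_def)
    have t_le: "t \<le> c / 2" "t \<le> e / 4 / (M + 1)"
      unfolding t_def by (rule min.cobounded1, rule min.cobounded2)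
    obtain h d' where h: "2-lipschitz_on UNIV h" "\<And>x. g x = 0 \<Longrightarrow> h x = 0" "\<And>x. \<bar>h x - g x\<bar> \<le> t"
      "d' > 0" "\<And>x y. x \<in> K \<Longrightarrow> y \<in> K \<Longrightarrow> dist x y < d' \<Longrightarrow> h x = h y"
      using locally_constant_approx[OF K(1,2) t g] by metis
    have hb: "h base_pt = 0"
      using h(2) f(1) h0(1) H(2) by (auto simp: g_def F_def)
    have hK: "\<bar>h x\<bar> \<le> c" if "x \<in> K" for x
      using h(3)[of x] h0(2)[OF that] t_le(1) unfolding g_def by linarith
    have "\<bar>pairing (m n) (\<lambda>x. h x - g x)\<bar> \<le> t * M"
      unfolding M_def by (rule abs_pairing_le) (rule h(3))
    also have "\<dots> \<le> e / 4 / (M + 1) * M"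
      using t_le(2) M by (rule mult_right_mono)
    also have "\<dots> \<le> e / 4"
      using M e by (simp add: field_simps)
    finally have hn: "pairing (m n) h \<ge> e / 2"
      using gn unfolding pairing_diff by linarith
    have "(\<lambda>x. s x + h x) \<in> S"
    proof -
      define L' where "L' = L + (4 - L) / 2"
      have L': "L' < 4" "2 \<le> L'" "L \<le> L'"
        using L by (auto simp: L'_def field_simps)
      have "L'-lipschitz_on K (\<lambda>x. s x + h x)"
      proof (rule lipschitz_onI)
        fix x y assume xy: "x \<in> K" "y \<in> K"
        show "dist (s x + h x) (s y + h y) \<le> L' * dist x y"
        proof (cases "dist x y < d")
          case True
          have "dist (h x) (h y) \<le> 2 * dist x y"
            using h(1) by (auto intro: lipschitz_onD)
          also have "\<dots> \<le> L' * dist x y"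
            using L' by (intro mult_right_mono) auto
          finally show ?thesis
            using d(2)[OF xy True] by (simp add: dist_real_def)
        next
          case False
          have "\<bar>s x - s y\<bar> \<le> L * dist x y"
            using lipschitz_onD[OF L(3) xy] by (simp add: dist_real_def)
          moreover have "\<bar>h x - h y\<bar> \<le> (4 - L) / 2 * dist x y"
          proof -
            have "\<bar>h x - h y\<bar> \<le> (4 - L) / 2 * d"
              using hK[OF xy(1)] hK[OF xy(2)] c(3) unfolding times_divide_eq_left by linarith
            also have "\<dots> \<le> (4 - L) / 2 * dist x y"
              using False L(1) by (intro mult_left_mono) auto
            finally show ?thesis .
          qed
          ultimately show ?thesis
            unfolding L'_def dist_real_def distrib_right by linarith
        qed
      qed (use L' in simp)
      moreover have "\<forall>x\<in>K. \<forall>y\<in>K. dist x y < min d d' \<longrightarrow> s x + h x = s y + h y"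
        using d(2) h(5) by (metis min_less_iff_conj)
      moreover have "s base_pt + h base_pt = 0" "min d d' > 0"
        using s0 hb d(1) h(4) by simp_all
      ultimately show ?thesis
        using L'(1,2) unfolding S_def by blast
    qed
    then show "\<exists>n\<ge>N. \<exists>h. (\<lambda>x. s x + h x) \<in> S \<and> (\<forall>x\<in>E. \<bar>h x\<bar> \<le> r) \<and> e / 2 \<le> pairing (m n) h"
      using n hn hK E c(2) by (intro exI[of _ n] exI[of _ h] conjI) fastforce+
  qed (use e in auto)
qed

section \<open>Countability of scattered compact sets\<close>

text \<open>A Cantor-Bendixson argument: \<open>V\<close> collects the balls of a countable family
  that meet \<open>K\<close> in a countable set. An isolated point of \<open>K - V\<close> would lie
  in a small ball of the family whose trace on \<open>K\<close> is countable, hence in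
  \<open>V\<close>.\<close>

lemma scattered_compact_countable:
  fixes K :: "'a::metric_space set"
  assumes K: "compact K" and scattered: "\<And>A. A \<subseteq> K \<Longrightarrow> A \<noteq> {} \<Longrightarrow> \<exists>x. x isolated_in A"
  shows "countable K"
proof -
  have "\<exists>P. finite P \<and> K \<subseteq> (\<Union>x\<in>P. ball x (1 / Suc n))" for n
    using K unfolding compact_eq_totally_bounded by simp
  then obtain P where P: "\<And>n. finite (P n)" "\<And>n. K \<subseteq> (\<Union>x\<in>P n. ball x (1 / Suc n))"
    by metis
  define \<B> where "\<B> = (\<Union>n. (\<lambda>x. ball x (1 / Suc n)) ` P n)"
  have \<B>: "countable \<B>"
    using P(1) by (auto simp: \<B>_def intro: countable_finite)
  define V where "V = \<Union>{B \<in> \<B>. countable (B \<inter> K)}"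
  have V: "countable (V \<inter> K)"
  proof -
    have "V \<inter> K = (\<Union>B\<in>{B \<in> \<B>. countable (B \<inter> K)}. B \<inter> K)"
      by (auto simp: V_def)
    then show ?thesis
      using \<B> by (simp only:) (intro countable_UN; auto)
  qed
  have "K - V = {}"
  proof (rule ccontr)
    assume "K - V \<noteq> {}"
    then obtain x where "x isolated_in (K - V)"
      using scattered[of "K - V"] by blast
    then obtain T where x: "x \<in> K" "x \<notin> V" and T: "open T" "T \<inter> (K - V) = {x}"
      by (auto simp: isolated_in_def)
    then obtain r where r: "r > 0" "ball x r \<subseteq> T"
      by (metis IntD1 insertI1 open_contains_ball)
    obtain n where n: "1 / Suc n < r / 2"
      using r(1) nat_approx_posE[of "r/2"] by auto
    obtain y where y: "y \<in> P n" "dist y x < 1 / Suc n"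
      using P(2)[of n] x(1) by auto
    let ?B = "ball y (1 / Suc n)"
    have "?B \<subseteq> ball x r"
    proof
      fix z assume "z \<in> ?B"
      then show "z \<in> ball x r"
        using dist_triangle3[of x z y] y n by (simp add: dist_commute)
    qed
    then have "?B \<inter> K \<subseteq> insert x (V \<inter> K)"
      using r(2) T(2) by blast
    then have "countable (?B \<inter> K)"
      using V by (metis countable_insert countable_subset)
    moreover have "?B \<in> \<B>"
      using y(1) by (auto simp: \<B>_def)
    ultimately have "x \<in> V"
      using y(2) by (auto simp: V_def)
    then show False
      using x(2) by simp
  qed
  then show ?thesis
    using V by (metis Diff_eq_empty_iff inf.absorb_iff2)
qed

section \<open>Iterated cutoffs down to a compact set\<close>

lemma weakly_null_meas_cutoff:
  assumes m: "weakly_null_meas m" and d: "d > 0" "base_pt \<in> E"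
  shows "weakly_null_meas (\<lambda>n x. cutoff E d x * m n x)"
  unfolding weakly_null_meas_def
proof (intro conjI allI impI)
  have fin: "finite {x. m n x \<noteq> 0}" for n
    using m by (simp add: weakly_null_meas_def)
  show "finite {x. cutoff E d x * m n x \<noteq> 0}" for n
    by (rule finite_subset[OF _ fin[of n]]) auto
  fix f :: "'a \<Rightarrow> real" and C
  assume f: "C-lipschitz_on UNIV f" "f base_pt = 0"
  have "(\<lambda>n. pairing (m n) (\<lambda>x. cutoff E d x * f x)) \<longlonglongrightarrow> 0"
    using m cutoff_mult_lipschitz[OF f d] f(2) unfolding weakly_null_meas_def
    by (metis mult_zero_right)
  then show "(\<lambda>n. pairing (\<lambda>x. cutoff E d x * m n x) f) \<longlonglongrightarrow> 0"
    by (simp add: pairing_weight[OF fin])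
qed

lemma weakly_null_measI:
  assumes fin: "\<And>n. finite {x. m n x \<noteq> 0}"
    and null: "\<And>f. 1-lipschitz_on UNIV f \<Longrightarrow> f base_pt = 0 \<Longrightarrow> (\<lambda>n. pairing (m n) f) \<longlonglongrightarrow> 0"
  shows "weakly_null_meas m"
  unfolding weakly_null_meas_def
proof (intro conjI allI impI fin)
  fix f :: "'a \<Rightarrow> real" and C
  assume f: "C-lipschitz_on UNIV f" "f base_pt = 0"
  have C: "C \<ge> 0"
    using f(1) by (rule lipschitz_on_nonneg)
  have "(\<bar>1 / (C + 1)\<bar> * C)-lipschitz_on UNIV (\<lambda>x. 1 / (C + 1) * f x)"
    by (intro lipschitz_on_cmult_real f)
  then have "1-lipschitz_on UNIV (\<lambda>x. 1 / (C + 1) * f x)"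
    by (rule lipschitz_on_mono) (use C in auto)
  then have "(\<lambda>n. pairing (m n) (\<lambda>x. 1 / (C + 1) * f x)) \<longlonglongrightarrow> 0"
    using f(2) by (intro null) auto
  then have "(\<lambda>n. (C + 1) * (1 / (C + 1) * pairing (m n) f)) \<longlonglongrightarrow> 0"
    unfolding pairing_cmult by (rule tendsto_mult_right_zero)
  then show "(\<lambda>n. pairing (m n) f) \<longlonglongrightarrow> 0"
    using C by simp
qed

text \<open>Repeated tightness at the scales \<open>d k\<close>, with errors \<open>c k\<close> of
  sum \<open>e / 2\<close>, multiplies the measures by ever more cutoffs. The limit weight
  \<open>V\<close> lives on a compact, hence countable, set, where the second gliding hump bounds
  the rest by \<open>e / 2\<close>.\<close>

lemma weakly_null_meas_uniformly_null:
  fixes m :: "nat \<Rightarrow> 'a::{pointed_metric_space, complete_space} \<Rightarrow> real"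
  assumes cnt: "\<And>K :: 'a set. compact K \<Longrightarrow> countable K" and m: "weakly_null_meas m" and e: "e > 0"
  shows "\<forall>\<^sub>F n in sequentially. \<forall>f. 1-lipschitz_on UNIV f \<longrightarrow> f base_pt = 0 \<longrightarrow> pairing (m n) f \<le> e"
proof -
  have fin: "finite {x. m n x \<noteq> 0}" for n
    using m by (simp add: weakly_null_meas_def)
  define d :: "nat \<Rightarrow> real" where "d k = (1/2) ^ (k + 3)" for k
  have d: "d k > 0" for k
    by (simp add: d_def)
  define c :: "nat \<Rightarrow> real" where "c k = e / 4 * (1/2) ^ k" for k
  have c: "c k > 0" for k
    using e by (simp add: c_def)
  \<comment> \<open>The last clause pins the start to the constant weight 1, since dependent choice
    does not return a prescribed first element.\<close>
  define P where "P k W \<longleftrightarrow> (\<forall>x. 0 \<le> W x) \<and> weakly_null_meas (\<lambda>n x. W x * m n x) \<and> (k = 0 \<longrightarrow> W = (\<lambda>_. 1))"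
    for k :: nat and W :: "'a \<Rightarrow> real"
  define R where "R k W W' E \<longleftrightarrow> finite E \<and> base_pt \<in> E \<and> W' = (\<lambda>x. cutoff E (d k) x * W x) \<and>
      (\<forall>n f. 1-lipschitz_on UNIV f \<longrightarrow> f base_pt = 0 \<longrightarrow>
        \<bar>pairing (\<lambda>x. W x * m n x) f - pairing (\<lambda>x. W' x * m n x) f\<bar> \<le> c k)"
    for k and W W' :: "'a \<Rightarrow> real" and E
  define Q where "Q k W W' \<longleftrightarrow> (\<exists>E. R k W W' E)" for k and W W' :: "'a \<Rightarrow> real"
  have "P 0 (\<lambda>_. 1)"
    using m by (simp add: P_def)
  moreover have "\<exists>W'. P (Suc k) W' \<and> Q k W W'" if W: "P k W" for k W
  proof -
    have null: "weakly_null_meas (\<lambda>n x. W x * m n x)"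
      using W by (simp add: P_def)
    then have finW: "finite {x. W x * m n x \<noteq> 0}" for n
      by (simp add: weakly_null_meas_def)
    obtain E where E: "finite E" "base_pt \<in> E" "\<And>n f. 1-lipschitz_on UNIV f \<Longrightarrow> f base_pt = 0 \<Longrightarrow>
        \<bar>pairing (\<lambda>x. W x * m n x) f - pairing (\<lambda>x. W x * m n x) (\<lambda>x. cutoff E (d k) x * f x)\<bar> \<le> c k"
      using weakly_null_meas_tight[OF null d c] by blast
    let ?W' = "\<lambda>x. cutoff E (d k) x * W x"
    have "P (Suc k) ?W'"
      using W cutoff_range(1)[of E "d k"] weakly_null_meas_cutoff[OF null d[of k] E(2)]
      by (simp add: P_def mult.assoc)
    moreover have "Q k W ?W'"
      unfolding Q_def R_def using E pairing_weight[OF finW]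
      by (intro exI[of _ E]) (simp add: mult.assoc)
    ultimately show ?thesis
      by blast
  qed
  ultimately obtain W where W: "\<And>k. P k (W k)" "\<And>k. Q k (W k) (W (Suc k))"
    using dependent_nat_choice[of P Q] by metis
  then obtain E where R: "\<And>k. R k (W k) (W (Suc k)) (E k)"
    unfolding Q_def by metis
  then have E: "\<And>k. finite (E k)" "\<And>k. base_pt \<in> E k"
      and W_eq: "\<And>k. W (Suc k) = (\<lambda>x. cutoff (E k) (d k) x * W k x)"
      and W_step: "\<And>k n f. 1-lipschitz_on UNIV f \<Longrightarrow> f base_pt = 0 \<Longrightarrow>
        \<bar>pairing (\<lambda>x. W k x * m n x) f - pairing (\<lambda>x. W (Suc k) x * m n x) f\<bar> \<le> c k"
    unfolding R_def by blast+
  have W_Suc: "W (Suc k) x = cutoff (E k) (d k) x * W k x" for k x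
    by (simp add: W_eq)
  have W0: "W 0 = (\<lambda>_. 1)" and W_nonneg: "\<And>k x. 0 \<le> W k x"
      and W_null: "\<And>k. weakly_null_meas (\<lambda>n x. W k x * m n x)"
    using W(1) by (auto simp: P_def)
  have dec: "decseq (\<lambda>k. W k x)" for x
    unfolding decseq_Suc_iff W_Suc
    by (intro allI mult_left_le_one_le W_nonneg cutoff_range)
  have "\<exists>l. (\<lambda>k. W k x) \<longlonglongrightarrow> l" for x
    using decseq_convergent[OF dec[of x], of 0] W_nonneg by blast
  then obtain V where V: "\<And>x. (\<lambda>k. W k x) \<longlonglongrightarrow> V x"
    by metis
  have V_nonneg: "0 \<le> V x" for x
    by (rule LIMSEQ_le_const[OF V]) (simp add: W_nonneg)
  have V_le: "V x \<le> W k x" for x k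
    by (rule decseq_ge[OF dec V])
  \<comment> \<open>The bound is the sum of the errors \<open>c j\<close> over
    \<open>j \<ge> k\<close>; it is uniform in \<open>n\<close> and \<open>f\<close>.\<close>
  have lim: "\<bar>pairing (\<lambda>x. W k x * m n x) f - pairing (\<lambda>x. V x * m n x) f\<bar> \<le> e / 2 * (1/2) ^ k"
    if f: "1-lipschitz_on UNIV f" "f base_pt = 0" for k n f
  proof -
    have partial: "\<bar>pairing (\<lambda>x. W k x * m n x) f - pairing (\<lambda>x. W j x * m n x) f\<bar>
        \<le> e / 2 * (1/2) ^ k - e / 2 * (1/2) ^ j" if "k \<le> j" for j
      using that
    proof (induction j rule: dec_induct)
      case (step j)
      then show ?case
        using W_step[OF f, of j n, unfolded abs_le_iff c_def] by (simp add: abs_le_iff)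
    qed simp
    have bound: "\<bar>pairing (\<lambda>x. W k x * m n x) f - pairing (\<lambda>x. W j x * m n x) f\<bar> \<le> e / 2 * (1/2) ^ k"
      if "k \<le> j" for j
    proof -
      have "0 \<le> e / 2 * (1/2) ^ j"
        using e by simp
      then show ?thesis
        using partial[OF that] by linarith
    qed
    have "(\<lambda>j. pairing (\<lambda>x. W j x * m n x) f) \<longlonglongrightarrow> pairing (\<lambda>x. V x * m n x) f"
      unfolding pairing_weight[OF fin] by (intro tendsto_pairing tendsto_mult V tendsto_const)
    then have "(\<lambda>j. \<bar>pairing (\<lambda>x. W k x * m n x) f - pairing (\<lambda>x. W j x * m n x) f\<bar>) \<longlonglongrightarrow>
        \<bar>pairing (\<lambda>x. W k x * m n x) f - pairing (\<lambda>x. V x * m n x) f\<bar>"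
      by (intro tendsto_intros)
    then show ?thesis
      by (rule LIMSEQ_le_const2) (use bound in blast)
  qed
  \<comment> \<open>The Lipschitz bounds for the cutoffs degenerate as \<open>d k\<close> tends to
    zero, so weak nullity is transferred from \<open>W k\<close> by the uniform estimate
    \<open>lim\<close> instead.\<close>
  have V_null: "weakly_null_meas (\<lambda>n x. V x * m n x)"
  proof (rule weakly_null_measI)
    show "finite {x. V x * m n x \<noteq> 0}" for n
      by (rule finite_subset[OF _ fin[of n]]) auto
    fix f :: "'a \<Rightarrow> real"
    assume f: "1-lipschitz_on UNIV f" "f base_pt = 0"
    show "(\<lambda>n. pairing (\<lambda>x. V x * m n x) f) \<longlonglongrightarrow> 0"
      unfolding tendsto_iff
    proof (intro allI impI)
      fix r :: real assume r: "r > 0"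
      obtain k where "(1/2) ^ k < r / e"
        using real_arch_pow_inv[of "r / e" "1/2"] e r by auto
      then have k: "e / 2 * (1/2) ^ k < r / 2"
        using e by (simp add: field_simps)
      have "(\<lambda>n. pairing (\<lambda>x. W k x * m n x) f) \<longlonglongrightarrow> 0"
        using W_null[of k] f by (auto simp: weakly_null_meas_def)
      then have "\<forall>\<^sub>F n in sequentially. \<bar>pairing (\<lambda>x. W k x * m n x) f\<bar> < r / 2"
        using r by (auto simp: tendsto_iff dest!: spec[of _ "r/2"])
      then show "\<forall>\<^sub>F n in sequentially. dist (pairing (\<lambda>x. V x * m n x) f) 0 < r"
      proof eventually_elim
        case (elim n)
        then show ?case
          using lim[OF f, of k n] k unfolding dist_real_def by linarith
      qed
    qed
  qed
  let ?K = "{x. \<forall>k. infdist x (E k) \<le> 2 * (1/2) ^ (k + 3) * radial x}"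
  have K: "compact ?K"
    using E by (rule compact_cutoff_limit)
  \<comment> \<open>As \<open>V\<close> lies below every \<open>W (Suc k)\<close>, all cutoffs are
    nonzero where \<open>V\<close> is.\<close>
  have supp: "x \<in> ?K" if "V x * m n x \<noteq> 0" for n x
  proof -
    have "cutoff (E k) (d k) x \<noteq> 0" for k
      using V_nonneg[of x] V_le[of x "Suc k"] that by (auto simp: W_Suc)
    then show ?thesis
      using cutoff_neq_0D[OF d] unfolding d_def by blast
  qed
  have base: "base_pt \<in> ?K"
    using E(2) by (simp add: radial_def)
  have "\<forall>\<^sub>F n in sequentially. \<forall>f. 1-lipschitz_on UNIV f \<longrightarrow> f base_pt = 0 \<longrightarrow>
      pairing (\<lambda>x. V x * m n x) f \<le> e / 2"
  proof (rule weakly_null_meas_countable_compact[OF V_null _ K cnt[OF K] base])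
    show "x \<in> ?K" if "V x * m n x \<noteq> 0" for n x
      using that by (rule supp)
    show "0 < e / 2"
      using e by simp
  qed
  then show ?thesis
  proof eventually_elim
    case (elim n)
    show ?case
    proof (intro allI impI)
      fix f :: "'a \<Rightarrow> real"
      assume f: "1-lipschitz_on UNIV f" "f base_pt = 0"
      have "pairing (m n) f \<le> pairing (\<lambda>x. V x * m n x) f + e / 2"
        using lim[OF f, of 0 n, unfolded abs_le_iff] by (simp add: W0)
      moreover have "pairing (\<lambda>x. V x * m n x) f \<le> e / 2"
        using elim f by blast
      ultimately show "pairing (m n) f \<le> e"
        by simp
    qed
  qed
qed

section \<open>The Schur property\<close>

lemma span_delta_pairing:
  assumes "u \<in> span (range delta)"
  shows "\<exists>m. finite {x. m x \<noteq> 0} \<and> (\<forall>f. blinfun_apply u f = pairing m (lip0_apply f))"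
  using assms
proof (induction rule: span_induct_alt)
  case base
  show ?case
    by (intro exI[of _ "\<lambda>_. 0"]) (simp add: pairing_def)
next
  case (step c v w)
  then obtain x m where v: "v = delta x" and m: "finite {x. m x \<noteq> 0}"
      "\<And>f. blinfun_apply w f = pairing m (lip0_apply f)"
    by blast
  define m' where "m' = m(x := m x + c)"
  let ?A = "insert x {x. m x \<noteq> 0}"
  have A: "finite ?A" "{x. m' x \<noteq> 0} \<subseteq> ?A" "{x. m x \<noteq> 0} \<subseteq> ?A"
    using m(1) by (auto simp: m'_def)
  have "blinfun_apply (c *\<^sub>R v + w) f = pairing m' (lip0_apply f)" for f
  proof -
    have "pairing m' (lip0_apply f) = (\<Sum>y\<in>?A. m y * lip0_apply f y + (if y = x then c * lip0_apply f x else 0))"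
      unfolding pairing_superset[OF A(1,2)] by (intro sum.cong) (auto simp: m'_def algebra_simps)
    also have "\<dots> = pairing m (lip0_apply f) + c * lip0_apply f x"
      using A(1) unfolding sum.distrib pairing_superset[OF A(1,3)] by simp
    finally show ?thesis
      by (simp add: v m(2) blinfun.add_left blinfun.scaleR_left delta.rep_eq)
  qed
  then show ?case
    using finite_subset[OF A(2,1)] by blast
qed

text \<open>Replacing each \<open>u n\<close> by an element of the span within
  \<open>inverse (Suc n)\<close> affects neither weak nor norm nullity. The norm of such an element
  is its supremum over the unit ball of \<open>lip0\<close>, so the uniform estimate for measures is
  norm convergence.\<close>

lemma schur_property_lipfree:
  assumes cnt: "\<And>K :: 'a::{pointed_metric_space, complete_space} set. compact K \<Longrightarrow> countable K"
  shows "schur_property TYPE('a lipfree)"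
  unfolding schur_property_def
proof (intro allI impI)
  fix u :: "nat \<Rightarrow> 'a lipfree"
  assume u: "weakly_null u"
  have inv: "inverse (real (Suc n)) > 0" for n
    by simp
  have "\<exists>v\<in>span (range delta). dist v (lipfree_functional (u n)) < inverse (real (Suc n))" for n
    using lipfree_functional[of "u n"] inv unfolding closure_approachable by blast
  then obtain v where v: "\<And>n. v n \<in> span (range delta)"
      "\<And>n. norm (v n - lipfree_functional (u n)) < inverse (real (Suc n))"
    unfolding dist_norm by metis
  obtain m where m: "\<And>n. finite {x. m n x \<noteq> 0}" "\<And>n f. blinfun_apply (v n) f = pairing (m n) (lip0_apply f)"
    using span_delta_pairing[OF v(1)] by metis
  have null: "(\<lambda>n. blinfun_apply (v n) f) \<longlonglongrightarrow> 0" for f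
  proof -
    have lin: "bounded_linear (\<lambda>w. blinfun_apply (lipfree_functional w) f)"
      by (rule bounded_linear_intro[where K = "norm f"])
         (auto simp: plus_lipfree.rep_eq scaleR_lipfree.rep_eq norm_lipfree.rep_eq
            blinfun.add_left blinfun.scaleR_left norm_blinfun simp del: real_norm_def)
    have "(\<lambda>n. blinfun_apply (Blinfun (\<lambda>w. blinfun_apply (lipfree_functional w) f)) (u n)) \<longlonglongrightarrow> 0"
      using u unfolding weakly_null_def by blast
    then have "(\<lambda>n. blinfun_apply (lipfree_functional (u n)) f) \<longlonglongrightarrow> 0"
      by (simp only: bounded_linear_Blinfun_apply[OF lin])
    moreover have "(\<lambda>n. blinfun_apply (v n - lipfree_functional (u n)) f) \<longlonglongrightarrow> 0"
    proof (rule Lim_null_comparison)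
      show "\<forall>\<^sub>F n in sequentially. norm (blinfun_apply (v n - lipfree_functional (u n)) f)
          \<le> inverse (real (Suc n)) * norm f"
        by (intro always_eventually allI order_trans[OF norm_blinfun] mult_right_mono
            less_imp_le[OF v(2)] norm_ge_zero)
      show "(\<lambda>n. inverse (real (Suc n)) * norm f) \<longlonglongrightarrow> 0"
        by (intro tendsto_mult_left_zero LIMSEQ_inverse_real_of_nat)
    qed
    ultimately show ?thesis
      using tendsto_add by (fastforce simp: blinfun.diff_left)
  qed
  have "weakly_null_meas m"
  proof (rule weakly_null_measI[OF m(1)])
    fix f :: "'a \<Rightarrow> real"
    assume "1-lipschitz_on UNIV f" "f base_pt = 0"
    then have "lip0_apply (Abs_lip0 f) = f"
      by (intro Abs_lip0_inverse) blast
    then show "(\<lambda>n. pairing (m n) f) \<longlonglongrightarrow> 0"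
      using null[of "Abs_lip0 f"] m(2) by simp
  qed
  note unif = weakly_null_meas_uniformly_null[OF cnt this]
  have "v \<longlonglongrightarrow> 0"
    unfolding tendsto_iff dist_norm
  proof (intro allI impI)
    fix e :: real assume e: "e > 0"
    have "\<forall>\<^sub>F n in sequentially. \<forall>f. 1-lipschitz_on UNIV f \<longrightarrow> f base_pt = 0 \<longrightarrow> pairing (m n) f \<le> e / 2"
      using e by (intro unif) auto
    then show "\<forall>\<^sub>F n in sequentially. norm (v n - 0) < e"
    proof eventually_elim
      case (elim n)
      have le: "blinfun_apply (v n) f \<le> e / 2 * norm f" for f
      proof (cases "f = 0")
        case True
        then show ?thesis
          by (simp add: blinfun.zero_right)
      next
        case False
        let ?g = "(1 / norm f) *\<^sub>R f"
        have "norm ?g = 1"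
          using False by simp
        then have "1-lipschitz_on UNIV (lip0_apply ?g)"
          using lip0_lipschitz[of ?g] by metis
        then have "blinfun_apply (v n) ?g \<le> e / 2"
          using elim by (simp add: m(2))
        then show ?thesis
          using False by (simp add: blinfun.scaleR_right divide_le_eq)
      qed
      have "norm (blinfun_apply (v n) f) \<le> e / 2 * norm f" for f
        using le[of f] le[of "- f"] by (simp add: blinfun.minus_right abs_le_iff)
      then have "norm (v n) \<le> e / 2"
        using e by (intro norm_blinfun_bound) auto
      then show ?case
        using e by simp
    qed
  qed
  moreover have "(\<lambda>n. v n - lipfree_functional (u n)) \<longlonglongrightarrow> 0"
  proof (rule Lim_null_comparison[OF _ LIMSEQ_inverse_real_of_nat])
    show "\<forall>\<^sub>F n in sequentially. norm (v n - lipfree_functional (u n)) \<le> inverse (real (Suc n))"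
      by (intro always_eventually allI less_imp_le v(2))
  qed
  ultimately have "(\<lambda>n. v n - (v n - lipfree_functional (u n))) \<longlonglongrightarrow> 0 - 0"
    by (rule tendsto_diff)
  then have "(\<lambda>n. norm (u n)) \<longlonglongrightarrow> 0"
    by (simp add: norm_lipfree.rep_eq tendsto_norm_zero)
  then show "u \<longlonglongrightarrow> 0"
    by (rule tendsto_norm_zero_cancel)
qed

text \<open>Both hypotheses make compact subsets countable: the first by passing to subsets, the
  second by \<open>scattered_compact_countable\<close>.\<close>

theorem corollary2p7:
  shows "(countable (UNIV :: 'a::{pointed_metric_space, complete_space} set)
            \<longrightarrow> schur_property TYPE('a lipfree))
       \<and> (scattered (UNIV :: 'a set) \<longrightarrow> schur_property TYPE('a lipfree))"
proof (intro conjI impI)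
  assume "countable (UNIV :: 'a set)"
  then show "schur_property TYPE('a lipfree)"
    by (intro schur_property_lipfree) (rule countable_subset[OF subset_UNIV])
next
  assume "scattered (UNIV :: 'a set)"
  then have isolated: "\<exists>x. x isolated_in A" if "A \<noteq> {}" for A :: "'a set"
    using that unfolding scattered_def by blast
  show "schur_property TYPE('a lipfree)"
    by (rule schur_property_lipfree) (metis scattered_compact_countable isolated)
qed

end
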